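(* Let $(l_1,\dots,l_m)$ (non-increasing) be the segment sequence of some $n$-vertex unicyclic graph, and suppose $l_1\geq 3$. Then for every $U\in \mathbb{U}(l_1,\dots,l_m)$, $$n(U)\leq n(U_1(l_1,\dots,l_m)).$$
   Context: A unicyclic graph is a connected graph containing exactly one cycle. A segment of a graph $G$ is a path in $G$ whose two end vertices each have degree $1$ or degree at least $3$ in $G$ and whose internal vertices all have degree $2$ in $G$; its length is its number of edges. The segment sequence of $G$ is the non-increasing sequence of the lengths of all segments of $G$. $\mathbb{U}(l_1,\dots,l_m)$ denotes the set of unicyclic graphs with segment sequence $(l_1,\dots,l_m)$. For $l_i\geq 3$, $U_i(l_1,\dots,l_m)$ denotes the graph in $\mathbb{U}(l_1,\dots,l_m)$ whose cycle consists of a single segment of length $l_i$ and in which all the other segments form a starlike tree, i.e. the graph obtained from the cycle $C_{l_i}$ by attaching, at one common vertex of the cycle, pendent paths of lengths $l_j$ for all $j\neq i$ (a pendent path of length $\ell$ at $w$ consists of $\ell$ new vertices $x_1,\dots,x_\ell$ and edges $wx_1,x_1x_2,\dots,x_{\ell-1}x_\ell$). A subtree of a graph is a subgraph that is a tree (distinguished as subgraphs); $n(G)$ is the number of subtrees of $G$, counting also the empty subtree. *)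

theory Defs
  imports "HOL-Library.Multiset"
begin

definition simple_graph :: "'a set \<Rightarrow> 'a set set \<Rightarrow> bool" where
  "simple_graph V E \<longleftrightarrow> finite V \<and> E \<subseteq> {{u, v} | u v. u \<in> V \<and> v \<in> V \<and> u \<noteq> v}"

definition adj :: "'a set set \<Rightarrow> 'a \<Rightarrow> 'a \<Rightarrow> bool" where
  "adj E u v \<longleftrightarrow> {u, v} \<in> E"

definition degree :: "'a set set \<Rightarrow> 'a \<Rightarrow> nat" where
  "degree E v = card {e \<in> E. v \<in> e}"

definition connected_graph :: "'a set \<Rightarrow> 'a set set \<Rightarrow> bool" where
  "connected_graph V E \<longleftrightarrow> V \<noteq> {} \<and> (\<forall>u\<in>V. \<forall>v\<in>V. (adj E)\<^sup>*\<^sup>* u v)"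

definition is_cycle :: "'a set set \<Rightarrow> 'a set set \<Rightarrow> bool" where
  "is_cycle E C \<longleftrightarrow> (\<exists>vs. length vs \<ge> 3 \<and> distinct vs \<and>
      C = {{vs ! i, vs ! ((i + 1) mod length vs)} | i. i < length vs} \<and> C \<subseteq> E)"

definition is_tree :: "'a set \<Rightarrow> 'a set set \<Rightarrow> bool" where
  "is_tree V E \<longleftrightarrow> simple_graph V E \<and> connected_graph V E \<and> \<not> (\<exists>C. is_cycle E C)"

definition unicyclic :: "'a set \<Rightarrow> 'a set set \<Rightarrow> bool" where
  "unicyclic V E \<longleftrightarrow> simple_graph V E \<and> connected_graph V E \<and> (\<exists>!C. is_cycle E C)"

text \<open>Subtrees: subgraphs (V',E') of (V,E) that are trees; n(G) counts them plus the empty one.\<close>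
definition subtrees :: "'a set \<Rightarrow> 'a set set \<Rightarrow> ('a set \<times> 'a set set) set" where
  "subtrees V E = {(V', E'). V' \<subseteq> V \<and> E' \<subseteq> E \<and> is_tree V' E'}"

definition num_subtrees :: "'a set \<Rightarrow> 'a set set \<Rightarrow> nat" where
  "num_subtrees V E = card (subtrees V E) + 1"

text \<open>A segment, given by a vertex sequence v_0,...,v_k (k \<ge> 1) with consecutive vertices
  adjacent, pairwise distinct edges, internal vertices distinct, distinct from the ends and of
  degree 2, and ends of degree 1 or \<ge> 3.  The two ends may coincide (this happens exactly when
  the cycle itself is a segment, as in the graphs U_i).  A segment is identified with its edge set.\<close>
definition is_segment :: "'a set set \<Rightarrow> 'a set set \<Rightarrow> bool" where
  "is_segment E S \<longleftrightarrow> (\<exists>vs. length vs \<ge> 2 \<and>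
      (\<forall>i < length vs - 1. {vs ! i, vs ! (i + 1)} \<in> E) \<and>
      distinct (map (\<lambda>i. {vs ! i, vs ! (i + 1)}) [0..<length vs - 1]) \<and>
      distinct (butlast (tl vs)) \<and>
      hd vs \<notin> set (butlast (tl vs)) \<and> last vs \<notin> set (butlast (tl vs)) \<and>
      (\<forall>v \<in> set (butlast (tl vs)). degree E v = 2) \<and>
      (degree E (hd vs) = 1 \<or> degree E (hd vs) \<ge> 3) \<and>
      (degree E (last vs) = 1 \<or> degree E (last vs) \<ge> 3) \<and>
      S = {{vs ! i, vs ! (i + 1)} | i. i < length vs - 1})"

definition segment_seq :: "'a set set \<Rightarrow> nat multiset" where
  "segment_seq E = image_mset card (mset_set {S. is_segment E S})"

text \<open>The graph U_1(l_1,...,l_m) for L = [l_1,...,l_m]: cycle on (0,0),...,(0,l_1-1);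
  for each 1 \<le> j < m, a pendent path (j,1),...,(j,L!j) attached at (0,0).\<close>
definition U1_V :: "nat list \<Rightarrow> (nat \<times> nat) set" where
  "U1_V L = {(0, i) | i. i < hd L} \<union>
            {(j, t) | j t. 1 \<le> j \<and> j < length L \<and> 1 \<le> t \<and> t \<le> L ! j}"

definition U1_E :: "nat list \<Rightarrow> (nat \<times> nat) set set" where
  "U1_E L = {{(0, i), (0, (i + 1) mod hd L)} | i. i < hd L} \<union>
            {{(0, 0), (j, 1)} | j. 1 \<le> j \<and> j < length L \<and> 1 \<le> L ! j} \<union>
            {{(j, t), (j, t + 1)} | j t. 1 \<le> j \<and> j < length L \<and> 1 \<le> t \<and> t < L ! j}"

end

theory Submission
  imports Defs "HOL-Library.FuncSet" "HOL-Library.Nat_Bijection"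
begin

text \<open>
  Orient the cycle cyclically and every other edge towards the cycle: a unicyclic graph becomes the
  digraph of a map \<open>g : V \<rightarrow> V\<close>, with edges \<open>{v, g v}\<close>. Every nonempty subtree has exactly one sink
  \<open>t\<close>, the vertex whose outgoing edge is missing, and the subtree is determined by \<open>t\<close> and its vertex
  set. Segments correspond to the vertices \<open>v\<close> of degree other than 2: follow \<open>g\<close> from \<open>v\<close>
  to the next such vertex.

  Let \<open>c\<close> be the cycle length, \<open>T l = l (l + 1) / 2\<close>, \<open>P\<close> the product of \<open>l + 1\<close> over the segments
  off the cycle and \<open>D\<close> the same product over the segments on it. Away from the \<open>T l\<close> subtrees inside
  one segment off the cycle, recording how much of each segment is used
  injects the subtrees into pairs of an arc of the cycle and a vector of lengths for the segments
  hanging from that arc. An arc and its complement have weights whose product is \<open>P\<close>, so their sum is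
  at most \<open>P\<close>, up to 1 for each of them meeting no branching vertex. This yields the bound
  \<open>P T c + \<Sum> T (l - 1) + \<Sum> T l\<close>, where the first sum ranges over the segments on the cycle and the second
  over the others. The claim follows from \<open>c (c + 1) \<le> m D\<close>, valid if all segments have length
  at most \<open>m\<close> and \<open>m \<ge> 3\<close>.
\<close>

subsection \<open>Arithmetic\<close>

text \<open>A pair \<open>(b, a)\<close> stands for the interval from \<open>a\<close> to
  \<open>b\<close>, so this counts the nonempty subpaths of a path with \<open>n\<close> vertices.
  The same index set serves the upper bound and the extremal graph.\<close>

lemma card_ordered_pairs: "card (SIGMA b:{..<n}. {..b}) = triangle n"
  by (induction n) (simp_all add: card_SigmaI)

text \<open>For \<open>a, b \<ge> 2\<close> the inequality \<open>(a - 1) * (b - 1) \<ge> 1\<close>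
  gives \<open>a + b \<le> a * b\<close>; a factor equal to 1 costs one extra unit. Applied to the
  weights of an arc and of its complement.\<close>

lemma add_le_of_mult_eq:
  fixes a b :: nat
  assumes "a * b = p" "0 < p"
  shows "a + b \<le> p + (if a = 1 then 1 else 0) + (if b = 1 then 1 else 0)"
proof (cases "a = 1 \<or> b = 1")
  case True
  then show ?thesis using assms by auto
next
  case False
  moreover have "a \<noteq> 0" "b \<noteq> 0" using assms by auto
  ultimately obtain a' b' where "a = a' + 2" "b = b' + 2"
    by (metis One_nat_def Suc_1 add.commute le_Suc_ex less_Suc_eq_le not_less_eq_eq less_one linorder_not_less nat_less_le)
  then show ?thesis using assms(1) by (simp add: algebra_simps)
qed

lemma two_triangle: "2 * triangle n = n * (n + 1)"
  by (induction n) (simp_all add: algebra_simps)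

lemma sum_le_prod_Suc:
  fixes f :: "'b \<Rightarrow> nat"
  shows "finite S \<Longrightarrow> (\<Sum>v\<in>S. f v) + 1 \<le> (\<Prod>v\<in>S. f v + 1)"
proof (induction rule: finite_induct)
  case (insert x F)
  have "(f x + 1) * ((\<Sum>v\<in>F. f v) + 1) \<le> (f x + 1) * (\<Prod>v\<in>F. f v + 1)"
    using insert.IH by (rule mult_le_mono2)
  moreover have "f x + (\<Sum>v\<in>F. f v) + 1 \<le> (f x + 1) * ((\<Sum>v\<in>F. f v) + 1)" by simp
  ultimately show ?case using insert.hyps by simp
qed simp

text \<open>Enlarging the sum \<open>c\<close> by \<open>f x\<close> raises the left side by
  \<open>f x * (2 * c + 1 + f x)\<close> and the right side by \<open>f x * (m * D)\<close>. For
  \<open>c \<ge> 1\<close> one has \<open>2 * c + 1 \<le> 3 * c \<le> m * c\<close>, so the increase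
  is covered because \<open>c + 1 \<le> D\<close>; the case \<open>c = 0\<close> is direct.\<close>

lemma sum_mult_le_prod:
  fixes f :: "'b \<Rightarrow> nat"
  assumes "finite S" "\<And>v. v \<in> S \<Longrightarrow> f v \<le> m" "3 \<le> m"
  shows "(\<Sum>v\<in>S. f v) * ((\<Sum>v\<in>S. f v) + 1) \<le> m * (\<Prod>v\<in>S. f v + 1)"
  using assms(1,2)
proof (induction rule: finite_induct)
  case (insert x F)
  define c where "c = (\<Sum>v\<in>F. f v)"
  define D where "D = (\<Prod>v\<in>F. f v + 1)"
  have IH: "c * (c + 1) \<le> m * D" using insert unfolding c_def D_def by simp
  have D: "c + 1 \<le> D" using sum_le_prod_Suc[OF insert.hyps(1)] unfolding c_def D_def by simp
  have x: "f x \<le> m" using insert.prems by simp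
  have "(c + f x) * (c + f x + 1) \<le> m * ((f x + 1) * D)"
  proof (cases "c = 0")
    case True
    have "1 \<le> D" using D by simp
    then have "f x + 1 \<le> (f x + 1) * D" using mult_le_mono2[of 1 D "f x + 1"] by simp
    then have "f x * (f x + 1) \<le> m * ((f x + 1) * D)" using x by (intro mult_le_mono)
    then show ?thesis unfolding True by (simp only: add_0)
  next
    case False
    have "2 * c + 1 \<le> 3 * c" using False by simp
    also have "\<dots> \<le> m * c" using assms(3) by simp
    finally have "2 * c + 1 + f x \<le> m * (c + 1)" using x by simp
    also have "\<dots> \<le> m * D" using D by (rule mult_le_mono2)
    finally have "f x * (2 * c + 1 + f x) \<le> f x * (m * D)" by (rule mult_le_mono2)
    then show ?thesis using IH by (simp add: algebra_simps)
  qed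
  then show ?case using insert.hyps by (simp add: c_def D_def ac_simps)
qed simp

text \<open>If \<open>m \<le> c\<close>, the first hypothesis multiplied by \<open>P\<close>
  suffices. If \<open>m = c + k\<close>, replacing \<open>D\<close> by its lower bound
  \<open>c + 1\<close> leaves the surplus \<open>k * (c + 1) * P \<ge> 2 * k\<close>, which pays for
  \<open>2 * m - 2 * c\<close>.\<close>

lemma weighted_prod_bound:
  fixes c m D P :: nat
  assumes "c * (c + 1) \<le> m * D" "c + 1 \<le> D" "1 \<le> c" "1 \<le> P"
  shows "c * (c + 1) * P + 2 * m \<le> m * (D * P) + 2 * c"
proof (cases "m \<le> c")
  case True
  have "c * (c + 1) * P \<le> m * D * P" using assms(1) by (rule mult_le_mono1)
  moreover have "2 * m \<le> 2 * c" using True by simp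
  ultimately have "c * (c + 1) * P + 2 * m \<le> m * D * P + 2 * c" by (rule add_mono)
  then show ?thesis by (simp only: mult.assoc)
next
  case False
  then obtain k where k: "m = c + k" by (metis le_add_diff_inverse nat_le_linear)
  have "2 * k \<le> k * ((c + 1) * P)"
  proof -
    have "2 * 1 \<le> (c + 1) * P" using assms by (intro mult_le_mono) auto
    then show ?thesis by (simp add: mult.commute)
  qed
  then have "c * (c + 1) * P + 2 * k \<le> m * ((c + 1) * P)"
    unfolding k by (simp add: algebra_simps)
  also have "\<dots> \<le> m * (D * P)" using assms(2) by (intro mult_le_mono order_refl)
  finally show ?thesis using k by simp
qed

subsection \<open>Functional graphs and their subtrees\<close>

lemma adj_sym: "adj E u v \<Longrightarrow> adj E v u"
  by (simp add: adj_def insert_commute)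

lemma adj_rtranclp_sym: "(adj E)\<^sup>*\<^sup>* u v \<Longrightarrow> (adj E)\<^sup>*\<^sup>* v u"
  by (induction rule: rtranclp_induct) (auto intro: converse_rtranclp_into_rtranclp adj_sym)

text \<open>An oriented unicyclic graph: \<open>reach\<close> leads every orbit into the cycle
  through \<open>r\<close>, while \<open>g_ne\<close> and \<open>gg_ne\<close> exclude cycles of
  length 1 and 2, so that distinct vertices give distinct edges with two ends.\<close>

locale functional_graph =
  fixes V :: "'a set" and g :: "'a \<Rightarrow> 'a" and r :: 'a
  assumes finV: "finite V"
    and g_in: "v \<in> V \<Longrightarrow> g v \<in> V"
    and g_ne: "v \<in> V \<Longrightarrow> g v \<noteq> v"
    and gg_ne: "v \<in> V \<Longrightarrow> g (g v) \<noteq> v"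
    and r_in: "r \<in> V"
    and reach: "v \<in> V \<Longrightarrow> \<exists>i. (g ^^ i) v = r"
begin

definition edge :: "'a \<Rightarrow> 'a set" where "edge v = {v, g v}"

definition edges :: "'a set set" where "edges = edge ` V"

text \<open>\<open>t\<close> is the sink. The last clause speaks of orbits in all of
  \<open>V\<close>, but by the closure clause the walk from \<open>v\<close> stays in
  \<open>X\<close> until it first meets \<open>t\<close>.\<close>

definition rooted :: "'a \<Rightarrow> 'a set \<Rightarrow> bool" where
  "rooted t X \<longleftrightarrow> X \<subseteq> V \<and> t \<in> X \<and> (\<forall>v\<in>X. v \<noteq> t \<longrightarrow> g v \<in> X) \<and> (\<forall>v\<in>X. \<exists>i. (g ^^ i) v = t)"

definition period :: nat where "period = (LEAST n. 0 < n \<and> (g ^^ n) r = r)"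

definition C :: "'a set" where "C = (\<lambda>i. (g ^^ i) r) ` {..<period}"

lemma funpow_in: "v \<in> V \<Longrightarrow> (g ^^ i) v \<in> V"
  by (induction i) (auto intro: g_in)

lemma funpow_diff: "i \<le> j \<Longrightarrow> (g ^^ (j - i)) ((g ^^ i) v) = (g ^^ j) v"
  by (metis comp_apply funpow_add le_add_diff_inverse2)

lemma edge_eq_iff: "u \<in> V \<Longrightarrow> v \<in> V \<Longrightarrow> edge u = edge v \<longleftrightarrow> u = v"
  using gg_ne by (fastforce simp: edge_def doubleton_eq_iff)

lemma inj_on_edge: "inj_on edge V"
  by (auto simp: inj_on_def edge_eq_iff)

lemma edge_iff: "{u, v} \<in> edge ` W \<longleftrightarrow> (u \<in> W \<and> v = g u) \<or> (v \<in> W \<and> u = g v)"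
  by (auto simp: edge_def doubleton_eq_iff image_iff)

section \<open>The cycle of a functional graph\<close>

lemma period_ex: "0 < period \<and> (g ^^ period) r = r"
proof -
  obtain i where "(g ^^ i) (g r) = r" using reach g_in r_in by blast
  then have "0 < Suc i \<and> (g ^^ Suc i) r = r" by (simp add: funpow_swap1)
  then show ?thesis unfolding period_def by (rule LeastI)
qed

lemma period_min: "0 < n \<Longrightarrow> n < period \<Longrightarrow> (g ^^ n) r \<noteq> r"
  using not_less_Least unfolding period_def by blast

lemma period_ge3: "3 \<le> period"
proof (rule ccontr)
  assume "\<not> 3 \<le> period"
  then have "period = 1 \<or> period = 2" using period_ex by linarith
  then show False using period_ex g_ne[OF r_in] gg_ne[OF r_in] by (auto simp: numeral_2_eq_2)
qed

lemma funpow_r_inj: "inj_on (\<lambda>i. (g ^^ i) r) {..<period}"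
proof -
  have "False" if "i < j" "j < period" "(g ^^ i) r = (g ^^ j) r" for i j
  proof -
    have "(g ^^ (period - j + i)) r = (g ^^ (period - j)) ((g ^^ j) r)"
      by (metis comp_apply funpow_add that(3))
    also have "\<dots> = (g ^^ (period - j + j)) r" by (simp only: funpow_add o_apply)
    also have "\<dots> = r" using that period_ex by simp
    finally have "(g ^^ (period - j + i)) r = r" .
    moreover have "0 < period - j + i" "period - j + i < period" using that by linarith+
    ultimately show False using period_min[of "period - j + i"] by simp
  qed
  then show ?thesis by (intro inj_onI) (metis lessThan_iff linorder_neqE_nat)
qed

lemma funpow_r_mod: "(g ^^ i) r = (g ^^ (i mod period)) r"
  using funpow_mod_eq[where f = g and n = period and x = r and m = i] period_ex by simp

lemma funpow_r_in_C: "(g ^^ i) r \<in> C"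
  unfolding C_def by (subst funpow_r_mod) (use period_ex in auto)

lemma card_C: "card C = period"
  unfolding C_def using card_image[OF funpow_r_inj] by simp

lemma C_subset: "C \<subseteq> V"
  unfolding C_def using funpow_in r_in by auto

lemma finC: "finite C"
  unfolding C_def by simp

lemma g_in_C: "x \<in> C \<Longrightarrow> g x \<in> C"
  using funpow_r_in_C[of "Suc _"] unfolding C_def by auto

lemma funpow_in_C: "x \<in> C \<Longrightarrow> (g ^^ i) x \<in> C"
  by (induction i) (auto intro: g_in_C)

lemma funpow_period: "x \<in> C \<Longrightarrow> (g ^^ period) x = x"
proof -
  assume "x \<in> C"
  then obtain i where "x = (g ^^ i) r" unfolding C_def by blast
  then have "(g ^^ period) x = (g ^^ (period + i)) r" by (simp add: funpow_add)
  also have "\<dots> = (g ^^ i) ((g ^^ period) r)" by (simp only: add.commute[of period] funpow_add o_apply)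
  finally have "(g ^^ period) x = (g ^^ i) ((g ^^ period) r)" .
  with \<open>x = _\<close> show ?thesis using period_ex by simp
qed

lemma inj_on_g_C: "inj_on g C"
proof (rule inj_onI)
  fix x y assume h: "x \<in> C" "y \<in> C" "g x = g y"
  have "(g ^^ period) z = (g ^^ (period - 1)) (g z)" for z
    using period_ex by (cases period) (simp_all add: funpow_swap1)
  then have "(g ^^ period) x = (g ^^ period) y" using h by simp
  then show "x = y" using h funpow_period by simp
qed

text \<open>The orbit of \<open>v\<close> meets \<open>r\<close> after \<open>i\<close> steps and is
  back at \<open>v\<close> after \<open>n * i \<ge> i\<close> steps, so \<open>v\<close> lies on the
  orbit of \<open>r\<close>.\<close>

lemma periodic_in_C: "v \<in> V \<Longrightarrow> 0 < n \<Longrightarrow> (g ^^ n) v = v \<Longrightarrow> v \<in> C"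
proof -
  assume h: "v \<in> V" "0 < n" "(g ^^ n) v = v"
  obtain i where i: "(g ^^ i) v = r" using reach h by blast
  have "(g ^^ (n * i)) v = v"
    using h(3) by (induction i) (simp_all add: funpow_add)
  moreover have "(g ^^ (n * i)) v = (g ^^ (n * i - i)) r"
  proof -
    have "i \<le> n * i" using h(2) by simp
    then have "(g ^^ (n * i)) v = (g ^^ (n * i - i)) ((g ^^ i) v)"
      by (metis comp_apply funpow_add le_add_diff_inverse2)
    then show ?thesis using i by simp
  qed
  ultimately show ?thesis using funpow_r_in_C by metis
qed

text \<open>Distinct points that reach each other are periodic, hence on the cycle. This
  antisymmetry identifies sinks off the cycle and excludes vertices beyond them.\<close>

lemma acyclic_off_C: "u \<in> V - C \<Longrightarrow> (g ^^ i) u = v \<Longrightarrow> (g ^^ j) v = u \<Longrightarrow> u = v"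
proof -
  assume h: "u \<in> V - C" "(g ^^ i) u = v" "(g ^^ j) v = u"
  then have "(g ^^ (j + i)) u = u" by (simp add: funpow_add)
  then have "j + i = 0" using periodic_in_C h by blast
  then show ?thesis using h by simp
qed

lemma C_reach: "x \<in> C \<Longrightarrow> y \<in> C \<Longrightarrow> \<exists>i<period. (g ^^ i) x = y"
proof -
  assume x: "x \<in> C" and y: "y \<in> C"
  \<comment> \<open>Some iterate of \<open>g\<close> maps \<open>x\<close> to \<open>r\<close>, so a
    coincidence among the iterates of \<open>x\<close> would carry over to \<open>r\<close>. Thus
    the first \<open>period\<close> iterates of \<open>x\<close> are distinct and fill
    \<open>C\<close>.\<close>
  have inj: "inj_on (\<lambda>i. (g ^^ i) x) {..<period}"
  proof -
    have "False" if "i < j" "j < period" "(g ^^ i) x = (g ^^ j) x" for i j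
    proof -
      obtain k where k: "x = (g ^^ k) r" using x unfolding C_def by blast
      obtain l where l: "(g ^^ l) x = r" using reach C_subset x by blast
      have sw: "(g ^^ l) ((g ^^ a) x) = (g ^^ a) r" for a
        by (metis add.commute comp_apply funpow_add l)
      have "(g ^^ i) r = (g ^^ j) r" using that(3) sw by metis
      then show False using funpow_r_inj that by (auto simp: inj_on_def)
    qed
    then show ?thesis by (intro inj_onI) (metis lessThan_iff linorder_neqE_nat)
  qed
  have "(\<lambda>i. (g ^^ i) x) ` {..<period} \<subseteq> C" using funpow_in_C x by auto
  then have "(\<lambda>i. (g ^^ i) x) ` {..<period} = C"
    using card_image[OF inj] card_C finC by (simp add: card_subset_eq)
  with y have "y \<in> (\<lambda>i. (g ^^ i) x) ` {..<period}" by simp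
  then show ?thesis by auto
qed

section \<open>Subtrees as vertex sets with a sink\<close>

lemma rooted_path: "rooted t X \<Longrightarrow> v \<in> X \<Longrightarrow> (adj (edge ` (X - {t})))\<^sup>*\<^sup>* v t"
proof -
  assume r: "rooted t X" and v: "v \<in> X"
  obtain i where "(g ^^ i) v = t" using r v unfolding rooted_def by blast
  then show ?thesis using v
  proof (induction i arbitrary: v)
    case 0 then show ?case by simp
  next
    case (Suc i)
    show ?case
    proof (cases "v = t")
      case False
      then have "g v \<in> X" using r Suc.prems unfolding rooted_def by blast
      moreover have "(g ^^ i) (g v) = t" using Suc.prems by (simp add: funpow_swap1)
      ultimately have "(adj (edge ` (X - {t})))\<^sup>*\<^sup>* (g v) t" using Suc.IH by blast
      moreover have "adj (edge ` (X - {t})) v (g v)"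
        using False Suc.prems by (auto simp: adj_def edge_iff)
      ultimately show ?thesis by (rule converse_rtranclp_into_rtranclp[rotated])
    qed simp
  qed
qed

text \<open>The number \<open>d\<close> of steps to the sink drops by one along each edge. At a
  vertex of a cycle where \<open>d\<close> is maximal, both neighbours on the cycle would be its
  image under \<open>g\<close>, impossible with at least three distinct vertices.\<close>

lemma rooted_acyclic: "rooted t X \<Longrightarrow> \<not> is_cycle (edge ` (X - {t})) Y"
proof
  assume r: "rooted t X" and "is_cycle (edge ` (X - {t})) Y"
  then obtain vs where vs: "length vs \<ge> 3" "distinct vs"
    "Y = {{vs ! i, vs ! ((i + 1) mod length vs)} | i. i < length vs}" "Y \<subseteq> edge ` (X - {t})"
    unfolding is_cycle_def by blast
  define n where "n = length vs"
  have n: "n \<ge> 3" using vs n_def by simp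
  define d where "d v = (LEAST i. (g ^^ i) v = t)" for v
  have dI: "(g ^^ d v) v = t" if "v \<in> X" for v
  proof -
    obtain i where "(g ^^ i) v = t" using r \<open>v \<in> X\<close> unfolding rooted_def by blast
    then show ?thesis unfolding d_def by (rule LeastI)
  qed
  have dg: "d v = Suc (d (g v))" if "v \<in> X - {t}" for v
  proof -
    have "g v \<in> X" using r that unfolding rooted_def by blast
    have "d v \<noteq> 0" using dI[of v] that by (metis DiffE funpow_0 insertI1)
    then obtain k where k: "d v = Suc k" using not0_implies_Suc by blast
    have "(g ^^ k) (g v) = t" using dI[of v] that k by (simp add: funpow_swap1)
    then have "d (g v) \<le> k" unfolding d_def by (rule Least_le)
    moreover have "(g ^^ Suc (d (g v))) v = t" using dI[OF \<open>g v \<in> X\<close>] by (simp add: funpow_swap1)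
    then have "d v \<le> Suc (d (g v))" unfolding d_def by (rule Least_le)
    ultimately show ?thesis using k by simp
  qed
  have "Max (d ` set vs) \<in> d ` set vs" using n n_def by (intro Max_in) auto
  then obtain i where i: "i < n" "d (vs ! i) = Max (d ` set vs)" by (metis imageE in_set_conv_nth n_def)
  have mx: "d u \<le> d (vs ! i)" if "u \<in> set vs" for u using i that by simp
  have nb: "u = g (vs ! i)" if "{vs ! i, u} \<in> Y" "u \<in> set vs" for u
  proof -
    have "{vs ! i, u} \<in> edge ` (X - {t})" using that vs by blast
    then consider "vs ! i \<in> X - {t} \<and> u = g (vs ! i)" | "u \<in> X - {t} \<and> vs ! i = g u"
      unfolding edge_iff by blast
    then show ?thesis
      by cases (use dg[of u] mx[OF that(2)] in auto)
  qed
  \<comment> \<open>The cyclic predecessor of \<open>i\<close>, written with \<open>n - 1\<close> to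
    avoid a negative index.\<close>
  define j where "j = (i + (n - 1)) mod n"
  have j: "j < n" "(j + 1) mod n = i"
    using i n by (auto simp: j_def mod_Suc_eq simp flip: add.assoc)
  have m: "(i + 1) mod n < n" using n by simp
  have "{vs ! i, vs ! ((i + 1) mod n)} \<in> Y" unfolding vs n_def[symmetric] using i by blast
  then have 1: "vs ! ((i + 1) mod n) = g (vs ! i)"
    using m by (intro nb) (simp_all add: n_def)
  have "{vs ! j, vs ! ((j + 1) mod n)} \<in> Y" unfolding vs n_def[symmetric] using j by blast
  then have "{vs ! i, vs ! j} \<in> Y" unfolding j(2) by (simp add: insert_commute)
  then have 2: "vs ! j = g (vs ! i)" using j by (intro nb) (simp_all add: n_def)
  have "(i + 1) mod n = j"
    using nth_eq_iff_index_eq[OF vs(2)] 1 2 j(1) m unfolding n_def by metis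
  then have "((i + 1) mod n + 1) mod n = i" using j(2) by simp
  then have "(i + 2) mod n = i" by (simp add: mod_Suc_eq)
  moreover have "(i + 2) mod n = (if i + 2 < n then i + 2 else i + 2 - n)"
    using i n by (simp add: mod_if)
  ultimately show False using n by (simp split: if_splits)
qed

definition tree_of :: "'a \<times> 'a set \<Rightarrow> 'a set \<times> 'a set set" where
  "tree_of = (\<lambda>(t, X). (X, edge ` (X - {t})))"

lemma rooted_subtree: "rooted t X \<Longrightarrow> tree_of (t, X) \<in> subtrees V edges"
proof -
  assume r: "rooted t X"
  then have X: "X \<subseteq> V" "t \<in> X" "\<And>v. v \<in> X \<Longrightarrow> v \<noteq> t \<Longrightarrow> g v \<in> X" unfolding rooted_def by auto
  have "simple_graph X (edge ` (X - {t}))"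
    unfolding simple_graph_def
  proof safe
    show "finite X" using X finV finite_subset by blast
    fix v assume v: "v \<in> X" "v \<noteq> t"
    show "\<exists>u w. edge v = {u, w} \<and> u \<in> X \<and> w \<in> X \<and> u \<noteq> w"
    proof -
      have "g v \<in> X" "v \<noteq> g v" using v X g_ne[of v] by auto
      then show ?thesis unfolding edge_def using v by blast
    qed
  qed
  moreover have "connected_graph X (edge ` (X - {t}))"
    unfolding connected_graph_def
    using X rooted_path[OF r] by (meson adj_rtranclp_sym empty_iff rtranclp_trans)
  ultimately show ?thesis
    unfolding tree_of_def subtrees_def is_tree_def edges_def using X rooted_acyclic[OF r] by auto
qed

lemma inj_on_tree_of: "inj_on tree_of {(t, X). rooted t X}"
proof (rule inj_onI; clarify)
  fix t X t' X' assume h: "rooted t X" "rooted t' X'" "tree_of (t, X) = tree_of (t', X')"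
  then have XX: "X = X'" and "edge ` (X - {t}) = edge ` (X - {t'})" by (auto simp: tree_of_def)
  moreover have "X \<subseteq> V" "t \<in> X" "t' \<in> X" using h XX unfolding rooted_def by auto
  ultimately have "X - {t} = X - {t'}"
    using inj_on_image_eq_iff[OF inj_on_edge, of "X - {t}" "X - {t'}"] by blast
  then show "t = t' \<and> X = X'" using XX \<open>t \<in> X\<close> \<open>t' \<in> X\<close> by blast
qed

text \<open>Stated for any edge set containing the cycle because it is applied to the edge set of a
  supposed subtree.\<close>

lemma edge_C_cycle: "is_cycle F (edge ` C)" if "edge ` C \<subseteq> F"
proof -
  define vs where "vs = map (\<lambda>i. (g ^^ i) r) [0..<period]"
  have len: "length vs = period" by (simp add: vs_def)
  have e: "{vs ! i, vs ! ((i + 1) mod length vs)} = edge ((g ^^ i) r)" if "i < period" for i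
    using that period_ge3 funpow_r_mod[of "Suc i"] by (simp add: edge_def vs_def)
  have "3 \<le> length vs" using period_ge3 len by simp
  moreover have "distinct vs"
    using funpow_r_inj by (simp add: vs_def distinct_map lessThan_atLeast0)
  moreover have "edge ` C = {{vs ! i, vs ! ((i + 1) mod length vs)} | i. i < length vs}"
  proof -
    have "edge ` C = (\<lambda>i. edge ((g ^^ i) r)) ` {..<period}" by (simp add: C_def image_image)
    also have "\<dots> = (\<lambda>i. {vs ! i, vs ! ((i + 1) mod length vs)}) ` {..<length vs}"
    proof (rule image_cong)
      show "{..<period} = {..<length vs}" by (simp add: len)
      show "edge ((g ^^ i) r) = {vs ! i, vs ! ((i + 1) mod length vs)}" if "i \<in> {..<length vs}" for i
        using e[of i] that len by (simp only: lessThan_iff)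
    qed
    finally show ?thesis by blast
  qed
  ultimately show ?thesis unfolding is_cycle_def using that by blast
qed

text \<open>If every vertex of the subtree kept its outgoing edge, orbits would stay inside and the
  whole cycle would be contained. So the edge leaving some \<open>t\<close> is missing, and
  connectedness forces every vertex to flow to \<open>t\<close>.\<close>

lemma subtree_rooted:
  assumes "(V', E') \<in> subtrees V edges"
  shows "\<exists>t. rooted t V' \<and> E' = edge ` (V' - {t})"
proof -
  have V': "V' \<subseteq> V" and E': "E' \<subseteq> edges" and tr: "is_tree V' E'"
    using assms unfolding subtrees_def by auto
  have sub: "u \<in> V' \<and> w \<in> V'" if "{u, w} \<in> E'" for u w
    using tr that unfolding is_tree_def simple_graph_def by (fastforce simp: doubleton_eq_iff)
  have ne: "V' \<noteq> {}" and conn: "\<And>u v. u \<in> V' \<Longrightarrow> v \<in> V' \<Longrightarrow> (adj E')\<^sup>*\<^sup>* u v"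
    using tr unfolding is_tree_def connected_graph_def by auto
  have "\<exists>t\<in>V'. edge t \<notin> E'"
  proof (rule ccontr)
    assume "\<not> ?thesis"
    then have all: "edge v \<in> E'" if "v \<in> V'" for v using that by blast
    have it: "(g ^^ i) v \<in> V'" if "v \<in> V'" for v i
      using that by (induction i) (use all sub in \<open>auto simp: edge_def\<close>)
    obtain v where "v \<in> V'" using ne by blast
    then have "r \<in> V'" using it reach V' by (metis subsetD)
    then have "C \<subseteq> V'" using it unfolding C_def by blast
    then have "is_cycle E' (edge ` C)" using all by (intro edge_C_cycle) blast
    then show False using tr unfolding is_tree_def by blast
  qed
  then obtain t where t: "t \<in> V'" "edge t \<notin> E'" by blast
  let ?step = "\<lambda>u w. w = g u \<and> edge u \<in> E'"
  have reach': "?step\<^sup>*\<^sup>* v t" if "v \<in> V'" for v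
  proof -
    have "(adj E')\<^sup>*\<^sup>* t v" using conn t that by blast
    then show ?thesis
    proof (induction rule: rtranclp_induct)
      case base show ?case by simp
    next
      case (step y z)
      have "{y, z} \<in> E'" using step.hyps by (simp add: adj_def)
      then have "{y, z} \<in> edge ` V" using E' unfolding edges_def by blast
      \<comment> \<open>Along a path starting at \<open>t\<close>, an edge directed away from
        \<open>t\<close> must be the first step of the directed walk already found from
        \<open>y\<close>; an edge directed towards \<open>t\<close> extends that walk by one
        step.\<close>
      then consider "z = g y" "edge y \<in> E'" | "y = g z" "edge z \<in> E'"
        using \<open>{y, z} \<in> E'\<close> unfolding edge_iff by (auto simp: edge_def insert_commute)
      then show ?case
      proof cases
        case 1
        then have "y \<noteq> t" using t by blast
        from step.IH show ?thesis
          by (cases rule: converse_rtranclpE) (use \<open>y \<noteq> t\<close> 1 in auto)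
      next
        case 2
        then have "?step z y" by simp
        then show ?thesis using step.IH by (rule converse_rtranclp_into_rtranclp)
      qed
    qed
  qed
  have out: "edge v \<in> E'" if "v \<in> V'" "v \<noteq> t" for v
    using reach'[OF that(1)] by (cases rule: converse_rtranclpE) (use that in auto)
  have "\<exists>i. (g ^^ i) v = t" if "v \<in> V'" for v
    using reach'[OF that]
  proof (induction rule: converse_rtranclp_induct)
    case base show ?case by (intro exI[of _ 0]) simp
  next
    case (step y z)
    then show ?case by (metis comp_apply funpow_Suc_right)
  qed
  moreover have "g v \<in> V'" if "v \<in> V'" "v \<noteq> t" for v
    using out[OF that] sub unfolding edge_def by blast
  ultimately have "rooted t V'"
    unfolding rooted_def using V' t by blast
  moreover have "E' = edge ` (V' - {t})"
  proof
    show "edge ` (V' - {t}) \<subseteq> E'" using out by auto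
    show "E' \<subseteq> edge ` (V' - {t})"
    proof
      fix e assume e: "e \<in> E'"
      then obtain v where v: "v \<in> V" "e = edge v" using E' unfolding edges_def by blast
      then have "v \<in> V'" using e sub by (auto simp: edge_def)
      then show "e \<in> edge ` (V' - {t})" using v e t by auto
    qed
  qed
  ultimately show ?thesis by blast
qed

lemma num_subtrees_eq: "num_subtrees V edges = card {(t, X). rooted t X} + 1"
proof -
  have "tree_of ` {(t, X). rooted t X} = subtrees V edges"
  proof
    show "tree_of ` {(t, X). rooted t X} \<subseteq> subtrees V edges" using rooted_subtree by auto
    show "subtrees V edges \<subseteq> tree_of ` {(t, X). rooted t X}"
    proof
      fix T assume "T \<in> subtrees V edges"
      moreover obtain V' E' where T: "T = (V', E')" by (cases T)
      ultimately obtain t where "rooted t V'" "E' = edge ` (V' - {t})" using subtree_rooted by blast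
      then show "T \<in> tree_of ` {(t, X). rooted t X}" unfolding T tree_of_def by auto
    qed
  qed
  then show ?thesis unfolding num_subtrees_def using card_image[OF inj_on_tree_of] by simp
qed

subsection \<open>Segments\<close>

definition preds :: "'a \<Rightarrow> 'a set" where "preds v = {u \<in> V. g u = v}"

text \<open>By \<open>degree_eq\<close> these are the vertices of degree other than 2, that is, the
  possible ends of segments.\<close>

definition N :: "'a set" where "N = {v \<in> V. card (preds v) \<noteq> 1}"

definition len :: "'a \<Rightarrow> nat" where "len v = (LEAST l. 0 < l \<and> (g ^^ l) v \<in> N)"

text \<open>The start is included and the next vertex of \<open>N\<close> is not. Hence the chains
  partition \<open>V\<close> when \<open>N\<close> is nonempty, and a chain has as many vertices as
  its segment has edges.\<close>

definition chain :: "'a \<Rightarrow> 'a set" where "chain v = (\<lambda>i. (g ^^ i) v) ` {..<len v}"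

definition root :: "'a \<Rightarrow> 'a" where "root v = (g ^^ (LEAST k. (g ^^ k) v \<in> C)) v"

lemma N_subset: "N \<subseteq> V"
  by (auto simp: N_def)

lemma finN: "finite N"
  using N_subset finV finite_subset by blast

lemma unique_pred: "v \<in> V - N \<Longrightarrow> \<exists>!u. u \<in> V \<and> g u = v"
proof -
  assume "v \<in> V - N"
  then have "card (preds v) = 1" by (simp add: N_def)
  then obtain u where "preds v = {u}" by (metis card_1_singletonE)
  then have "u \<in> V \<and> g u = v" "\<And>w. w \<in> V \<and> g w = v \<Longrightarrow> w = u" by (auto simp: preds_def)
  then show ?thesis by blast
qed

lemma pred_eq: "v \<in> V - N \<Longrightarrow> u \<in> V \<Longrightarrow> u' \<in> V \<Longrightarrow> g u = v \<Longrightarrow> g u' = v \<Longrightarrow> u = u'"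
  using unique_pred by blast

lemma degree_eq: "v \<in> V \<Longrightarrow> degree edges v = card (preds v) + 1"
proof -
  assume v: "v \<in> V"
  have "{e \<in> edges. v \<in> e} = edge ` insert v (preds v)"
    using v by (auto simp: edges_def edge_def preds_def)
  moreover have "inj_on edge (insert v (preds v))"
    using v by (intro inj_on_subset[OF inj_on_edge]) (auto simp: preds_def)
  ultimately have "degree edges v = card (insert v (preds v))"
    unfolding degree_def by (metis card_image)
  moreover have "v \<notin> preds v" "finite (preds v)" using g_ne finV by (auto simp: preds_def)
  ultimately show ?thesis by simp
qed

text \<open>\<open>g u\<close> has the predecessor \<open>u\<close> off the cycle and a second one
  on it, found by going \<open>period - 1\<close> steps round the cycle.\<close>

lemma enter_C: "u \<in> V - C \<Longrightarrow> g u \<in> C \<Longrightarrow> g u \<in> N"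
proof -
  assume u: "u \<in> V - C" "g u \<in> C"
  define w where "w = (g ^^ (period - 1)) (g u)"
  have w: "w \<in> C" using u funpow_in_C by (simp add: w_def)
  have "g w = (g ^^ Suc (period - 1)) (g u)" by (simp add: w_def)
  also have "\<dots> = g u" using period_ex funpow_period[OF u(2)] by simp
  finally show ?thesis using pred_eq[of "g u" u w] u w C_subset by auto
qed

lemma reach_C: "v \<in> V \<Longrightarrow> w \<in> C \<Longrightarrow> \<exists>i. (g ^^ i) v = w"
proof -
  assume h: "v \<in> V" "w \<in> C"
  obtain i where "(g ^^ i) v = r" using reach h by blast
  moreover obtain j where "w = (g ^^ j) r" using h unfolding C_def by blast
  ultimately have "(g ^^ (j + i)) v = w" by (simp add: funpow_add)
  then show ?thesis by blast
qed

lemma root_C: "v \<in> C \<Longrightarrow> root v = v"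
proof -
  assume "v \<in> C"
  then have "(LEAST k. (g ^^ k) v \<in> C) = 0" by (intro Least_eq_0) simp
  then show ?thesis by (simp add: root_def)
qed

lemma root_g: "v \<in> V - C \<Longrightarrow> root (g v) = root v"
proof -
  assume v: "v \<in> V - C"
  obtain n where "(g ^^ n) v = r" using reach v by blast
  then have "(g ^^ n) v \<in> C" using funpow_r_in_C[of 0] by simp
  then have "(LEAST k. (g ^^ k) v \<in> C) = Suc (LEAST k. (g ^^ Suc k) v \<in> C)"
    using v by (intro Least_Suc) auto
  then show ?thesis by (simp add: root_def funpow_swap1)
qed

lemma root_in: "v \<in> V \<Longrightarrow> root v \<in> C"
proof -
  assume v: "v \<in> V"
  obtain n where "(g ^^ n) v = r" using reach v by blast
  then have "(g ^^ n) v \<in> C" using funpow_r_in_C[of 0] by simp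
  then show ?thesis unfolding root_def by (rule LeastI)
qed

lemma root_in_N: "v \<in> V - C \<Longrightarrow> root v \<in> N"
proof -
  assume v: "v \<in> V - C"
  obtain i where "(g ^^ i) v = r" using reach v by blast
  then show ?thesis using v
  proof (induction i arbitrary: v)
    case 0
    then show ?case using funpow_r_in_C[of 0] by simp
  next
    case (Suc i)
    show ?case
    proof (cases "g v \<in> C")
      case True
      then show ?thesis using enter_C Suc.prems root_C root_g by metis
    next
      case False
      then show ?thesis using Suc.IH[of "g v"] Suc.prems g_in root_g by (simp add: funpow_swap1)
    qed
  qed
qed

lemma root_funpow: "v \<in> V \<Longrightarrow> (g ^^ i) v = t \<Longrightarrow> t \<notin> C \<Longrightarrow> root v = root t"
proof (induction i arbitrary: v)
  case (Suc i)
  have "v \<notin> C" using Suc.prems funpow_in_C by blast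
  then show ?case using Suc.IH[of "g v"] Suc.prems g_in root_g by (simp add: funpow_swap1)
qed simp

text \<open>The walk from \<open>v\<close> to the sink stays in \<open>X\<close>, and it enters the
  cycle at \<open>root v\<close>.\<close>

lemma root_rooted: "rooted t X \<Longrightarrow> t \<in> C \<Longrightarrow> v \<in> X \<Longrightarrow> root v \<in> X"
proof -
  assume X: "rooted t X" and t: "t \<in> C" and v: "v \<in> X"
  obtain i where "(g ^^ i) v = t" using X v unfolding rooted_def by blast
  then show ?thesis using v
  proof (induction i arbitrary: v)
    case 0 then show ?case using root_C t by simp
  next
    case (Suc i)
    show ?case
    proof (cases "v \<in> C")
      case True then show ?thesis using root_C Suc by simp
    next
      case False
      then have "v \<noteq> t" using t by blast
      then have "g v \<in> X" using X Suc.prems(2) unfolding rooted_def by blast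
      then have "root (g v) \<in> X" using Suc by (simp add: funpow_swap1)
      then show ?thesis using root_g False Suc.prems X unfolding rooted_def by (metis DiffI subsetD)
    qed
  qed
qed

section \<open>Segments as edge sets of chains\<close>

lemma segment_of_path:
  assumes "0 < k" "\<And>i. i \<le> k \<Longrightarrow> p i \<in> V" "\<And>i. i < k \<Longrightarrow> g (p i) = p (Suc i)"
    "p 0 \<in> N" "p k \<in> N" "\<And>i. 0 < i \<Longrightarrow> i < k \<Longrightarrow> p i \<notin> N"
  shows "{{p i, p (Suc i)} | i. i < k} = edge ` chain (p 0)"
proof -
  have pw: "p i = (g ^^ i) (p 0)" if "i \<le> k" for i
    using that
  proof (induction i)
    case (Suc i) then show ?case using assms(3)[of i] by simp
  qed simp
  have "len (p 0) = k"
    unfolding len_def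
  proof (rule Least_equality)
    show "0 < k \<and> (g ^^ k) (p 0) \<in> N" using assms(1,5) pw[of k] by auto
    show "k \<le> l" if "0 < l \<and> (g ^^ l) (p 0) \<in> N" for l
      using that assms(6)[of l] pw[of l] by (metis linorder_not_less less_imp_le)
  qed
  then have "edge ` chain (p 0) = (\<lambda>i. edge (p i)) ` {..<k}"
    unfolding chain_def image_image by (intro image_cong) (simp_all add: pw[symmetric])
  also have "\<dots> = {{p i, p (Suc i)} | i. i < k}"
    using assms(3) by (auto simp: edge_def)
  finally show ?thesis by simp
qed

text \<open>The orientation cannot change inside a segment: two edges pointing at an inner vertex
  contradict its unique predecessor, two pointing away from it contradict that \<open>g\<close> is a
  function. So the segment is directed one way, and its first vertex in that direction names
  it.\<close>

lemma segment_chain: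
  assumes "is_segment edges S"
  shows "\<exists>v\<in>N. S = edge ` chain v"
proof -
  obtain vs where vs: "length vs \<ge> 2"
      "\<And>i. i < length vs - 1 \<Longrightarrow> {vs ! i, vs ! (i + 1)} \<in> edges"
      "distinct (map (\<lambda>i. {vs ! i, vs ! (i + 1)}) [0..<length vs - 1])"
      "\<And>v. v \<in> set (butlast (tl vs)) \<Longrightarrow> degree edges v = 2"
      "degree edges (hd vs) = 1 \<or> degree edges (hd vs) \<ge> 3"
      "degree edges (last vs) = 1 \<or> degree edges (last vs) \<ge> 3"
      "S = {{vs ! i, vs ! (i + 1)} | i. i < length vs - 1}"
    using assms unfolding is_segment_def by blast
  define k where "k = length vs - 1"
  define p where "p i = vs ! i" for i
  have k: "0 < k" using vs(1) k_def by simp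
  have e: "{p i, p (Suc i)} \<in> edges" if "i < k" for i
    using vs(2) that by (simp add: k_def p_def)
  have dist: "i = j" if "{p i, p (Suc i)} = {p j, p (Suc j)}" "i < k" "j < k" for i j
    using vs(3) that by (auto simp: distinct_map inj_on_def k_def p_def)
  have fb: "p i \<in> V \<and> p (Suc i) \<in> V \<and> (g (p i) = p (Suc i) \<or> g (p (Suc i)) = p i)" if "i < k" for i
    using e[OF that] g_in unfolding edges_def edge_iff by metis
  have pV: "p i \<in> V" if "i \<le> k" for i
  proof (cases "i < k")
    case False
    then have "i = Suc (k - 1)" "k - 1 < k" using that k by auto
    then show ?thesis using fb by metis
  qed (use fb in auto)
  have int: "p i \<notin> N" if "0 < i" "i < k" for i
  proof -
    have "butlast (tl vs) ! (i - 1) = p i" "i - 1 < length (butlast (tl vs))"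
      using that by (auto simp: k_def p_def nth_butlast nth_tl)
    then have "degree edges (p i) = 2" using vs(4) nth_mem by metis
    then show ?thesis using degree_eq pV[of i] that by (simp add: N_def)
  qed
  have endN: "p i \<in> N" if "i = 0 \<or> i = k" for i
  proof -
    have "vs \<noteq> []" using vs(1) by auto
    then have "hd vs = p 0" "last vs = p k" by (auto simp: p_def k_def hd_conv_nth last_conv_nth)
    then have "degree edges (p i) \<noteq> 2" using vs(5,6) that by auto
    moreover have "p i \<in> V" using that pV by auto
    ultimately show ?thesis using degree_eq by (simp add: N_def)
  qed
  have fwd: "g (p (Suc i)) = p (Suc (Suc i))" if "g (p i) = p (Suc i)" "Suc i < k" for i
  proof (rule ccontr)
    assume "\<not> ?thesis"
    then have "g (p (Suc (Suc i))) = p (Suc i)" using fb that by blast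
    moreover have "p (Suc i) \<in> V - N" using that(2) int[of "Suc i"] pV[of "Suc i"] by simp
    moreover have "p (Suc (Suc i)) \<in> V" "p i \<in> V" using that(2) pV by simp_all
    ultimately have "p (Suc (Suc i)) = p i" using pred_eq that(1) by blast
    then show False using dist[of i "Suc i"] that by auto
  qed
  have bwd: "g (p (Suc (Suc i))) = p (Suc i)" if "g (p (Suc i)) = p i" "Suc i < k" for i
  proof (rule ccontr)
    assume "\<not> ?thesis"
    then have "g (p (Suc i)) = p (Suc (Suc i))" using fb that by blast
    then show False using dist[of i "Suc i"] that by auto
  qed
  have S: "S = {{p i, p (Suc i)} | i. i < k}" by (simp add: vs(7) p_def k_def)
  consider "g (p 0) = p (Suc 0)" | "g (p (Suc 0)) = p 0" using fb k by blast
  then show ?thesis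
  proof cases
    case 1
    have "g (p i) = p (Suc i)" if "i < k" for i
      using that by (induction i) (use 1 fwd in auto)
    then have "S = edge ` chain (p 0)"
      unfolding S using k pV endN int by (intro segment_of_path) auto
    then show ?thesis using endN by blast
  next
    case 2
    have b: "g (p (Suc i)) = p i" if "i < k" for i
      using that by (induction i) (use 2 bwd in auto)
    \<comment> \<open>A segment listed against the orientation is reversed so that
      \<open>segment_of_path\<close> applies.\<close>
    define q where "q i = p (k - i)" for i
    have "{{q i, q (Suc i)} | i. i < k} = edge ` chain (q 0)"
    proof (rule segment_of_path)
      show "g (q i) = q (Suc i)" if "i < k" for i
        using b[of "k - Suc i"] that by (simp add: q_def Suc_diff_Suc)
    qed (use k pV endN int in \<open>auto simp: q_def\<close>)
    moreover have "{{q i, q (Suc i)} | i. i < k} = S"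
    proof -
      have "{q i, q (Suc i)} = {p (k - Suc i), p (Suc (k - Suc i))}" if "i < k" for i
        using that by (auto simp: q_def Suc_diff_Suc)
      then have "{{q i, q (Suc i)} | i. i < k} = (\<lambda>i. {p (k - Suc i), p (Suc (k - Suc i))}) ` {..<k}"
        by (auto simp: image_iff)
      also have "\<dots> = (\<lambda>i. {p i, p (Suc i)}) ` (\<lambda>i. k - Suc i) ` {..<k}" by (simp add: image_image)
      also have "(\<lambda>i. k - Suc i) ` {..<k} = {..<k}"
        proof (intro equalityI subsetI)
          fix x assume "x \<in> {..<k}"
          then show "x \<in> (\<lambda>i. k - Suc i) ` {..<k}" by (intro image_eqI[of _ _ "k - Suc x"]) auto
        qed auto
      finally show ?thesis unfolding S by auto
    qed
    moreover have "q 0 \<in> N" using endN[of k] by (simp add: q_def)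
    ultimately show ?thesis by blast
  qed
qed

lemma N_C_ne: "N \<noteq> {} \<Longrightarrow> N \<inter> C \<noteq> {}"
proof -
  assume "N \<noteq> {}"
  then obtain v where v: "v \<in> N" by blast
  show ?thesis
  proof (cases "v \<in> C")
    case False
    then show ?thesis using root_in_N[of v] root_in[of v] v N_subset by blast
  qed (use v in blast)
qed

lemma len_ex: "N \<noteq> {} \<Longrightarrow> v \<in> V \<Longrightarrow> 0 < len v \<and> (g ^^ len v) v \<in> N"
proof -
  assume "N \<noteq> {}" and v: "v \<in> V"
  then obtain w where "w \<in> N" "w \<in> C" using N_C_ne by blast
  then obtain i where "(g ^^ i) (g v) \<in> N" using reach_C[of "g v" w] g_in v by blast
  then have "0 < Suc i \<and> (g ^^ Suc i) v \<in> N" by (simp add: funpow_swap1)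
  then show ?thesis unfolding len_def by (rule LeastI)
qed

lemma len_N: "v \<in> N \<Longrightarrow> 0 < len v \<and> (g ^^ len v) v \<in> N"
  using len_ex N_subset by blast

lemma len_min: "0 < i \<Longrightarrow> i < len v \<Longrightarrow> (g ^^ i) v \<notin> N"
  using not_less_Least unfolding len_def by blast

text \<open>Walk backwards from the common vertex. Predecessors are unique outside \<open>N\<close>,
  so both walks agree until one reaches its start in \<open>N\<close>, and then so does the
  other.\<close>

lemma chain_inj:
  "\<lbrakk>v \<in> N; v' \<in> N; i < len v; j < len v'; (g ^^ i) v = (g ^^ j) v'\<rbrakk> \<Longrightarrow> v = v' \<and> i = j"
proof (induction i arbitrary: j)
  case 0
  then have "j = 0" using len_min[of j v'] by (cases "j = 0") auto
  then show ?case using 0 by simp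
next
  case (Suc i)
  have nN: "(g ^^ Suc i) v \<notin> N" using len_min[of "Suc i" v] Suc.prems(3) by blast
  then have "j \<noteq> 0" using Suc.prems(2,5) by (metis funpow_0)
  then obtain j' where j': "j = Suc j'" using not0_implies_Suc by blast
  have "(g ^^ i) v = (g ^^ j') v'"
  proof (rule pred_eq)
    show "(g ^^ Suc i) v \<in> V - N" using nN Suc.prems(1) N_subset funpow_in by blast
    show "(g ^^ i) v \<in> V" "(g ^^ j') v' \<in> V" using Suc.prems(1,2) N_subset funpow_in by blast+
    show "g ((g ^^ j') v') = (g ^^ Suc i) v" using Suc.prems(5) j' by simp
  qed simp
  then show ?case using Suc.IH[of j'] Suc.prems j' by auto
qed

lemma v_in_chain: "v \<in> N \<Longrightarrow> v \<in> chain v"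
proof -
  assume "v \<in> N"
  then have "0 < len v" using len_N by blast
  then show ?thesis unfolding chain_def by (intro image_eqI[of _ _ 0]) simp_all
qed

lemma chain_subset: "v \<in> N \<Longrightarrow> chain v \<subseteq> V"
  using funpow_in N_subset by (auto simp: chain_def)

lemma chain_disjoint: "v \<in> N \<Longrightarrow> v' \<in> N \<Longrightarrow> x \<in> chain v \<Longrightarrow> x \<in> chain v' \<Longrightarrow> v = v'"
  using chain_inj unfolding chain_def by blast

lemma inj_on_chain: "v \<in> N \<Longrightarrow> inj_on (\<lambda>i. (g ^^ i) v) {..<len v}"
  using chain_inj by (auto intro!: inj_onI)

lemma card_chain: "v \<in> N \<Longrightarrow> card (chain v) = len v"
  unfolding chain_def using card_image[OF inj_on_chain] by simp

lemma chain_succ: "v \<in> N \<Longrightarrow> z \<in> chain v \<Longrightarrow> g z \<in> N \<or> g z \<in> chain v"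
proof -
  assume v: "v \<in> N" and "z \<in> chain v"
  then obtain i where i: "i < len v" "z = (g ^^ i) v" unfolding chain_def by blast
  show ?thesis
  proof (cases "Suc i < len v")
    case True
    then have "(g ^^ Suc i) v \<in> chain v" unfolding chain_def by blast
    then show ?thesis using i by simp
  next
    case False
    then have "len v = Suc i" using i by simp
    then show ?thesis using len_N[OF v] i by simp
  qed
qed

text \<open>The unique predecessor of an inner vertex of a chain is on the chain, so a chain can be
  entered from outside only at its start.\<close>

lemma chain_pred: "v \<in> N \<Longrightarrow> z \<in> V \<Longrightarrow> g z \<in> chain v \<Longrightarrow> g z \<noteq> v \<Longrightarrow> z \<in> chain v"
proof -
  assume h: "v \<in> N" "z \<in> V" "g z \<in> chain v" "g z \<noteq> v"
  then obtain i where i: "i < len v" "g z = (g ^^ i) v" unfolding chain_def by blast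
  then obtain j where j: "i = Suc j" using h(4) by (cases i) auto
  have "z = (g ^^ j) v"
  proof (rule pred_eq)
    show "g z \<in> V - N" using i j g_in[OF h(2)] len_min[of i v] by simp
    show "(g ^^ j) v \<in> V" using h(1) N_subset funpow_in by blast
    show "g ((g ^^ j) v) = g z" using i j by simp
  qed (use h in simp_all)
  then show ?thesis using i j unfolding chain_def by auto
qed

text \<open>The predecessor of an uncovered vertex is uncovered, so by finiteness \<open>g\<close>
  maps the uncovered set onto itself. But every orbit meets \<open>N\<close>, which is
  covered.\<close>

lemma chain_cover: "N \<noteq> {} \<Longrightarrow> x \<in> V \<Longrightarrow> \<exists>v\<in>N. x \<in> chain v"
proof (rule ccontr)
  assume ne: "N \<noteq> {}" and x: "x \<in> V" "\<not> (\<exists>v\<in>N. x \<in> chain v)"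
  define Y where "Y = {x \<in> V. \<not> (\<exists>v\<in>N. x \<in> chain v)}"
  have "Y \<subseteq> g ` Y"
  proof
    fix y assume y: "y \<in> Y"
    then have "y \<in> V - N" using v_in_chain unfolding Y_def by blast
    then obtain u where u: "u \<in> V" "g u = y" using unique_pred by blast
    have "u \<in> Y"
      using u y chain_succ v_in_chain unfolding Y_def by blast
    then show "y \<in> g ` Y" using u by blast
  qed
  moreover have finY: "finite Y" using finV unfolding Y_def by simp
  ultimately have "g ` Y = Y" using surj_card_le card_image_le by (metis card_seteq finite_imageI)
  then have it: "(g ^^ i) x \<in> Y" for i
    using x by (induction i) (auto simp: Y_def)
  then show False using len_ex[OF ne x(1)] v_in_chain unfolding Y_def by blast
qed

definition head :: "'a \<Rightarrow> 'a" where "head x = (THE v. v \<in> N \<and> x \<in> chain v)"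

lemma head_eq: "v \<in> N \<Longrightarrow> x \<in> chain v \<Longrightarrow> head x = v"
  unfolding head_def using chain_disjoint by blast

lemma head_in: "N \<noteq> {} \<Longrightarrow> x \<in> V \<Longrightarrow> head x \<in> N \<and> x \<in> chain (head x)"
  using chain_cover head_eq by metis

text \<open>By \<open>enter_C\<close> the cycle is entered only at a vertex of \<open>N\<close>,
  where the chain has already stopped.\<close>

lemma chain_off_C: "v \<in> N - C \<Longrightarrow> chain v \<inter> C = {}"
proof -
  assume v: "v \<in> N - C"
  have "(g ^^ i) v \<notin> C" if "i < len v" for i
    using that
  proof (induction i)
    case (Suc i)
    then show ?case
      using enter_C[of "(g ^^ i) v"] len_min[of "Suc i" v] v N_subset funpow_in by auto
  qed (use v in simp)
  then show ?thesis unfolding chain_def by blast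
qed

lemma chain_in_C: "v \<in> C \<Longrightarrow> chain v \<subseteq> C"
  using funpow_in_C unfolding chain_def by blast

lemma period_sum: "N \<noteq> {} \<Longrightarrow> period = (\<Sum>v\<in>N \<inter> C. len v)"
proof -
  assume ne: "N \<noteq> {}"
  have "C = (\<Union>v\<in>N \<inter> C. chain v)"
  proof
    show "C \<subseteq> (\<Union>v\<in>N \<inter> C. chain v)"
    proof
      fix x assume x: "x \<in> C"
      then obtain v where v: "v \<in> N" "x \<in> chain v" using chain_cover[OF ne] C_subset by blast
      then have "v \<in> C" using chain_off_C[of v] x by blast
      then show "x \<in> (\<Union>v\<in>N \<inter> C. chain v)" using v by blast
    qed
  qed (use chain_in_C in blast)
  moreover have "card (\<Union>v\<in>N \<inter> C. chain v) = (\<Sum>v\<in>N \<inter> C. card (chain v))"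
  proof (rule card_UN_disjoint)
    show "\<forall>v\<in>N \<inter> C. finite (chain v)" by (simp add: chain_def)
    show "\<forall>v\<in>N \<inter> C. \<forall>w\<in>N \<inter> C. v \<noteq> w \<longrightarrow> chain v \<inter> chain w = {}"
      using chain_disjoint by (metis IntD1 disjoint_iff)
  qed (simp add: finN)
  ultimately have "card C = (\<Sum>v\<in>N \<inter> C. card (chain v))" by argo
  also have "\<dots> = (\<Sum>v\<in>N \<inter> C. len v)" using card_chain by (intro sum.cong) auto
  finally show ?thesis using card_C by simp
qed

lemma chain_segment:
  assumes v: "v \<in> N"
  shows "is_segment edges (edge ` chain v)"
proof -
  have vV: "v \<in> V" using v N_subset by blast
  note l = len_N[OF v]
  \<comment> \<open>One vertex more than the chain: the end in \<open>N\<close> belongs to the list,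
    and it may coincide with \<open>v\<close>.\<close>
  define vs where "vs = map (\<lambda>i. (g ^^ i) v) [0..<Suc (len v)]"
  have len: "length vs - 1 = len v" by (simp add: vs_def)
  have nth: "vs ! i = (g ^^ i) v" if "i \<le> len v" for i
    using that by (auto simp: vs_def simp del: upt_Suc)
  have ed: "{vs ! i, vs ! (i + 1)} = edge ((g ^^ i) v)" if "i < len v" for i
    using that by (simp add: nth edge_def)
  have mid: "butlast (tl vs) = map (\<lambda>i. (g ^^ i) v) [1..<len v]"
  proof -
    have "[0..<Suc (len v)] = 0 # [1..<len v] @ [len v]" using l by (simp add: upt_conv_Cons)
    then show ?thesis by (simp add: vs_def butlast_append del: upt_Suc)
  qed
  have "hd vs = v" by (simp add: vs_def hd_map del: upt_Suc)
  moreover have "last vs = (g ^^ len v) v" by (simp add: vs_def)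
  ultimately have hd: "hd vs = v" "last vs = (g ^^ len v) v" by simp_all
  have midN: "u \<notin> N" "u \<in> V" if "u \<in> set (butlast (tl vs))" for u
    using that len_min vV funpow_in unfolding mid by auto
  have deg: "degree edges u = 1 \<or> degree edges u \<ge> 3" if "u \<in> N" for u
    using that degree_eq[of u] by (auto simp: N_def)
  have "distinct (map (\<lambda>i. {vs ! i, vs ! (i + 1)}) [0..<length vs - 1])"
  proof -
    have "map (\<lambda>i. {vs ! i, vs ! (i + 1)}) [0..<length vs - 1] = map edge (map (\<lambda>i. (g ^^ i) v) [0..<len v])"
      unfolding len map_map o_def by (rule map_cong[OF refl], rule ed) simp
    moreover have "distinct (map (\<lambda>i. (g ^^ i) v) [0..<len v])"
      using inj_on_chain[OF v] by (simp add: distinct_map lessThan_atLeast0)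
    moreover have "inj_on edge (set (map (\<lambda>i. (g ^^ i) v) [0..<len v]))"
      using vV funpow_in by (intro inj_on_subset[OF inj_on_edge]) auto
    ultimately show ?thesis by (simp only: distinct_map)
  qed
  moreover have "distinct (butlast (tl vs))"
    unfolding mid by (auto simp: distinct_map intro: inj_on_subset[OF inj_on_chain[OF v]])
  moreover have "edge ` chain v = {{vs ! i, vs ! (i + 1)} | i. i < length vs - 1}"
    unfolding len chain_def image_image using ed by blast
  moreover have "{vs ! i, vs ! (i + 1)} \<in> edges" if "i < length vs - 1" for i
    using that ed vV funpow_in unfolding len edges_def by auto
  moreover have "degree edges u = 2" if "u \<in> set (butlast (tl vs))" for u
    using midN[OF that] degree_eq by (simp add: N_def)
  moreover have "hd vs \<notin> set (butlast (tl vs))" "last vs \<notin> set (butlast (tl vs))"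
    using midN v l unfolding hd by blast+
  moreover have "2 \<le> length vs" using l by (simp add: vs_def)
  ultimately show ?thesis
    unfolding is_segment_def using deg v l hd by (intro exI[of _ vs]) auto
qed

text \<open>\<open>N\<close> indexes the segments without repetition, since chains are disjoint and
  \<open>edge\<close> is injective.\<close>

lemma segment_seq_eq: "segment_seq edges = image_mset len (mset_set N)"
proof -
  have inj: "inj_on (\<lambda>v. edge ` chain v) N"
  proof (rule inj_onI)
    fix u v assume h: "u \<in> N" "v \<in> N" "edge ` chain u = edge ` chain v"
    then have "chain u = chain v"
      using inj_on_image_eq_iff[OF inj_on_edge chain_subset[OF h(1)] chain_subset[OF h(2)]] by simp
    then show "u = v" using h v_in_chain chain_disjoint by metis
  qed
  have "{S. is_segment edges S} = (\<lambda>v. edge ` chain v) ` N"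
    using segment_chain chain_segment by blast
  then have "mset_set {S. is_segment edges S} = image_mset (\<lambda>v. edge ` chain v) (mset_set N)"
    using inj by (simp add: image_mset_mset_set)
  then have "segment_seq edges = image_mset (\<lambda>v. card (edge ` chain v)) (mset_set N)"
    unfolding segment_seq_def by (simp add: image_mset.compositionality o_def)
  also have "\<dots> = image_mset len (mset_set N)"
  proof (rule image_mset_cong)
    fix v assume "v \<in># mset_set N"
    then have v: "v \<in> N" using finN by simp
    then have "card (edge ` chain v) = card (chain v)"
      using chain_subset inj_on_edge by (meson card_image inj_on_subset)
    then show "card (edge ` chain v) = len v" using card_chain v by simp
  qed
  finally show ?thesis .
qed

subsection \<open>Upper bound\<close>

definition arc :: "'a \<Rightarrow> nat \<Rightarrow> 'a set" where "arc x n = (\<lambda>i. (g ^^ i) x) ` {..<n}"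

text \<open>An upper bound for the choices hanging from the cycle vertex \<open>w\<close>: each
  segment there is cut at one of \<open>len v + 1\<close> places. The empty product gives 1 when
  nothing hangs from \<open>w\<close>.\<close>

definition wt :: "'a \<Rightarrow> nat" where "wt w = (\<Prod>v\<in>{v \<in> N - C. root v = w}. len v + 1)"

definition arc_wt :: "'a \<Rightarrow> nat \<Rightarrow> nat" where "arc_wt x n = (\<Prod>i<n. wt ((g ^^ i) x))"

text \<open>On each chain such a set is a terminal piece. Nothing is required where a chain ends, so
  connectedness is given up; this makes room for the encodings of subtrees with sink off the
  cycle.\<close>

definition chain_closed :: "'a set \<Rightarrow> 'a set set" where
  "chain_closed Q = {Z. Z \<subseteq> {v \<in> V - C. root v \<in> Q} \<and> (\<forall>z\<in>Z. g z \<notin> N \<longrightarrow> g z \<in> Z)}"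

lemma root_chain: "v \<in> N - C \<Longrightarrow> x \<in> chain v \<Longrightarrow> root x = root v"
proof -
  assume h: "v \<in> N - C" "x \<in> chain v"
  then obtain i where "(g ^^ i) v = x" by (auto simp: chain_def)
  moreover have "x \<notin> C" using chain_off_C h by blast
  moreover have "v \<in> V" using h N_subset by blast
  ultimately show ?thesis using root_funpow[of v i x] by simp
qed

lemma head_off_C: "x \<in> V - C \<Longrightarrow> head x \<in> N - C \<and> x \<in> chain (head x)"
proof -
  assume x: "x \<in> V - C"
  then have "N \<noteq> {}" using root_in_N by blast
  then have "head x \<in> N" "x \<in> chain (head x)" using head_in x by blast+
  then show ?thesis using chain_in_C[of "head x"] x by blast
qed

lemma chain_closed_up:
  assumes "Z \<in> chain_closed Q" "i \<le> j" "j < len v" "(g ^^ i) v \<in> Z"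
  shows "(g ^^ j) v \<in> Z"
  using assms(2,3)
proof (induction j rule: dec_induct)
  case base
  then show ?case using assms(4) by simp
next
  case (step k)
  then have "(g ^^ k) v \<in> Z" by simp
  then show ?case
    using assms(1) len_min[of "Suc k" v] step.prems unfolding chain_closed_def by auto
qed

lemma finite_chain_closed: "finite (chain_closed Q)"
  by (rule finite_subset[of _ "Pow V"]) (auto simp: chain_closed_def finV)

text \<open>Two terminal pieces of one chain are nested, so a piece is determined by its size, for
  which there are \<open>len v + 1\<close> values. The chains in question cover every chain-closed
  set over \<open>Q\<close>.\<close>

lemma card_chain_closed: "card (chain_closed Q) \<le> (\<Prod>v\<in>{v \<in> N - C. root v \<in> Q}. len v + 1)"
proof -
  define I where "I = {v \<in> N - C. root v \<in> Q}"
  define f where "f Z = (\<lambda>v\<in>I. card (Z \<inter> chain v))" for Z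
  have finI: "finite I" using finN by (simp add: I_def)
  have "inj_on f (chain_closed Q)"
  proof (rule inj_onI)
    fix Z Z' assume Z: "Z \<in> chain_closed Q" and Z': "Z' \<in> chain_closed Q" and eq: "f Z = f Z'"
    have same: "Z \<inter> chain v = Z' \<inter> chain v" if v: "v \<in> I" for v
    proof -
      have c: "card (Z \<inter> chain v) = card (Z' \<inter> chain v)"
        using fun_cong[OF eq, of v] v by (simp add: f_def)
      have fin: "finite (Z \<inter> chain v)" "finite (Z' \<inter> chain v)" by (auto simp: chain_def)
      have "Z \<inter> chain v \<subseteq> Z' \<inter> chain v \<or> Z' \<inter> chain v \<subseteq> Z \<inter> chain v"
      proof (rule ccontr)
        assume "\<not> ?thesis"
        then obtain x y where xy: "x \<in> chain v" "x \<in> Z" "x \<notin> Z'" "y \<in> chain v" "y \<in> Z'" "y \<notin> Z"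
          by blast
        then obtain i j where ij: "i < len v" "x = (g ^^ i) v" "j < len v" "y = (g ^^ j) v"
          unfolding chain_def by blast
        show False
        proof (cases "i \<le> j")
          case True
          then show False using chain_closed_up[OF Z True] ij xy by blast
        next
          case False
          then have "j \<le> i" by simp
          then show False using chain_closed_up[OF Z'] ij xy by blast
        qed
      qed
      then show ?thesis using c fin by (metis card_subset_eq)
    qed
    have cover: "Y \<subseteq> (\<Union>v\<in>I. chain v)" if "Y \<in> chain_closed Q" for Y
    proof
      fix y assume "y \<in> Y"
      then have y: "y \<in> V - C" "root y \<in> Q" using that unfolding chain_closed_def by blast+
      then have "head y \<in> N - C" "y \<in> chain (head y)" using head_off_C by blast+
      then show "y \<in> (\<Union>v\<in>I. chain v)" using y root_chain unfolding I_def by auto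
    qed
    show "Z = Z'" using cover[OF Z] cover[OF Z'] same by blast
  qed
  moreover have "f ` chain_closed Q \<subseteq> (\<Pi>\<^sub>E v\<in>I. {..len v})"
  proof (rule image_subsetI)
    fix Z
    have "card (Z \<inter> chain v) \<le> len v" if "v \<in> I" for v
      using that card_chain[of v] card_mono[of "chain v" "Z \<inter> chain v"]
      by (simp add: I_def chain_def)
    then show "f Z \<in> (\<Pi>\<^sub>E v\<in>I. {..len v})" by (auto simp: f_def)
  qed
  ultimately have "card (chain_closed Q) \<le> card (\<Pi>\<^sub>E v\<in>I. {..len v})"
    using finI by (intro card_inj_on_le finite_PiE) auto
  also have "\<dots> = (\<Prod>v\<in>I. len v + 1)" using finI by (simp add: card_PiE)
  finally show ?thesis by (simp add: I_def)
qed

section \<open>Arcs of the cycle\<close>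

lemma inj_on_funpow_C: "inj_on (g ^^ n) C"
proof (induction n)
  case (Suc n)
  then show ?case
    using inj_on_g_C funpow_in_C by (auto simp: inj_on_def)
qed (simp add: inj_on_def)

lemma bij_funpow_C: "bij_betw (g ^^ n) C C"
proof -
  have "(g ^^ n) ` C \<subseteq> C" using funpow_in_C by blast
  then show ?thesis
    using inj_on_funpow_C endo_inj_surj[OF finC] unfolding bij_betw_def by blast
qed

lemma arc_full: "x \<in> C \<Longrightarrow> arc x period = C"
  using C_reach funpow_in_C unfolding arc_def by (auto simp: image_iff)

lemma inj_on_arc: "x \<in> C \<Longrightarrow> inj_on (\<lambda>i. (g ^^ i) x) {..<period}"
  using arc_full card_C unfolding arc_def by (intro eq_card_imp_inj_on) auto

lemma prod_wt: "finite Q \<Longrightarrow> (\<Prod>v\<in>{v \<in> N - C. root v \<in> Q}. len v + 1) = (\<Prod>w\<in>Q. wt w)"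
proof -
  assume Q: "finite Q"
  let ?S = "{v \<in> N - C. root v \<in> Q}"
  have "(\<Prod>v\<in>?S. len v + 1) = (\<Prod>w\<in>Q. \<Prod>v\<in>{v \<in> ?S. root v = w}. len v + 1)"
    using Q finN by (intro prod.group[symmetric]) auto
  also have "\<dots> = (\<Prod>w\<in>Q. wt w)"
    unfolding wt_def by (intro prod.cong refl) auto
  finally show ?thesis .
qed

lemma prod_arc:
  assumes "x \<in> C" "n \<le> period"
  shows "(\<Prod>w\<in>arc x n. wt w) = arc_wt x n"
proof -
  have "inj_on (\<lambda>i. (g ^^ i) x) {..<n}" using inj_on_arc[OF assms(1)] assms(2) by (auto intro: inj_on_subset)
  then show ?thesis unfolding arc_wt_def arc_def by (simp add: prod.reindex)
qed

lemma card_chain_closed_arc: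
  "x \<in> C \<Longrightarrow> n \<le> period \<Longrightarrow> card (chain_closed (arc x n)) \<le> arc_wt x n"
  using card_chain_closed[of "arc x n"] prod_wt[of "arc x n"] prod_arc by (simp add: arc_def)

text \<open>Inside a chain, \<open>X\<close> is the interval of positions from its first vertex, at
  \<open>a\<close>, to the sink, at \<open>b\<close>; a vertex past the sink could not lead back to
  it. The parametrisation \<open>f\<close> only has to be onto, as an upper bound is wanted.\<close>

lemma card_intervals:
  "card {(t, X). rooted t X \<and> (\<exists>v\<in>N - C. X \<subseteq> chain v)} \<le> (\<Sum>v\<in>N - C. triangle (len v))"
proof -
  define I where "I = (SIGMA v:N - C. SIGMA b:{..<len v}. {..b})"
  define f where "f = (\<lambda>(v, b, a). ((g ^^ b) v, (\<lambda>i. (g ^^ i) v) ` {a..b}))"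
  have "{(t, X). rooted t X \<and> (\<exists>v\<in>N - C. X \<subseteq> chain v)} \<subseteq> f ` I"
  proof clarify
    fix t X v assume r: "rooted t X" and v: "v \<in> N" "v \<notin> C" and X: "X \<subseteq> chain v"
    have "t \<in> chain v" using r X unfolding rooted_def by blast
    then obtain b where b: "b < len v" "t = (g ^^ b) v" unfolding chain_def by blast
    have tC: "t \<in> V - C" using \<open>t \<in> chain v\<close> v chain_off_C chain_subset by blast
    define a where "a = (LEAST i. (g ^^ i) v \<in> X)"
    have tX: "(g ^^ b) v \<in> X" using r b unfolding rooted_def by simp
    then have a: "(g ^^ a) v \<in> X" "a \<le> b" unfolding a_def by (rule LeastI, rule Least_le)
    have up: "(g ^^ i) v \<in> X" if "a \<le> i" "i \<le> b" for i
      using that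
    proof (induction i rule: dec_induct)
      case base then show ?case using a by simp
    next
      case (step i)
      have "(g ^^ i) v \<noteq> t" using chain_inj[of v v i b] step b v by auto
      then show ?case using step r unfolding rooted_def by simp
    qed
    have "X \<subseteq> (\<lambda>i. (g ^^ i) v) ` {a..b}"
    proof
      fix x assume x: "x \<in> X"
      then obtain i where i: "i < len v" "x = (g ^^ i) v" using X unfolding chain_def by blast
      have "a \<le> i" unfolding a_def using x i by (intro Least_le) simp
      moreover have "i \<le> b"
      proof (rule ccontr)
        assume "\<not> i \<le> b"
        then have "(g ^^ (i - b)) t = x"
          using funpow_diff[of b i v] i b by simp
        moreover obtain k where "(g ^^ k) x = t" using r x unfolding rooted_def by blast
        ultimately have "t = x" using acyclic_off_C tC by blast
        then show False using chain_inj[of v v i b] i b v \<open>\<not> i \<le> b\<close> by auto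
      qed
      ultimately show "x \<in> (\<lambda>i. (g ^^ i) v) ` {a..b}" using i by auto
    qed
    then have "X = (\<lambda>i. (g ^^ i) v) ` {a..b}" using up by auto
    then have "(t, X) = f (v, b, a)" using b by (simp add: f_def)
    moreover have "(v, b, a) \<in> I" using v b a by (auto simp: I_def)
    ultimately show "(t, X) \<in> f ` I" by (rule image_eqI)
  qed
  moreover have finI: "finite I" using finN by (auto simp: I_def)
  ultimately have "card {(t, X). rooted t X \<and> (\<exists>v\<in>N - C. X \<subseteq> chain v)} \<le> card I"
    by (meson card_image_le card_mono finite_imageI order_trans)
  also have "card I = (\<Sum>v\<in>N - C. triangle (len v))"
    unfolding I_def using finN by (subst card_SigmaI) (auto simp: card_ordered_pairs)
  finally show ?thesis .
qed

text \<open>The arc starts at the vertex of \<open>X\<close> on the cycle that needs the most steps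
  to \<open>t\<close>; closure under \<open>g\<close> fills in the rest. For
  \<open>n = period\<close> it is the whole cycle, cut open at the edge leaving
  \<open>t\<close>.\<close>

lemma rooted_on_cycle:
  assumes r: "rooted t X" and t: "t \<in> C"
  shows "\<exists>x n. x \<in> C \<and> 1 \<le> n \<and> n \<le> period \<and> X \<inter> C = arc x n \<and> t = (g ^^ (n - 1)) x"
proof -
  define D where "D = {d. d < period \<and> (\<exists>x\<in>X \<inter> C. (g ^^ d) x = t)}"
  have finD: "finite D" by (simp add: D_def)
  have "0 \<in> D" using r t period_ex unfolding D_def rooted_def by auto
  then have "Max D \<in> D" using finD Max_in by blast
  then obtain x where x: "x \<in> X \<inter> C" "(g ^^ Max D) x = t" "Max D < period" unfolding D_def by blast
  have up: "(g ^^ i) x \<in> X" if "i \<le> Max D" for i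
    using that
  proof (induction i)
    case (Suc i)
    have "(g ^^ i) x \<noteq> t"
      using inj_onD[OF inj_on_arc, of x i "Max D"] x Suc.prems by auto
    then show ?case using Suc r unfolding rooted_def by simp
  qed (use x in simp)
  have "X \<inter> C = arc x (Suc (Max D))"
  proof
    show "arc x (Suc (Max D)) \<subseteq> X \<inter> C" using up x funpow_in_C unfolding arc_def by auto
    show "X \<inter> C \<subseteq> arc x (Suc (Max D))"
    proof
      fix y assume y: "y \<in> X \<inter> C"
      obtain e where e: "e < period" "(g ^^ e) y = t" using C_reach y t by blast
      then have "e \<in> D" using y unfolding D_def by blast
      then have le: "e \<le> Max D" using finD by simp
      have "(g ^^ e) ((g ^^ (Max D - e)) x) = (g ^^ e) y"
        using x(2) e(2) le by (metis comp_apply funpow_add le_add_diff_inverse)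
      from inj_onD[OF inj_on_funpow_C this] have "y = (g ^^ (Max D - e)) x"
        using x(1) y funpow_in_C by simp
      then show "y \<in> arc x (Suc (Max D))" unfolding arc_def by auto
    qed
  qed
  then show ?thesis using x by (intro exI[of _ x] exI[of _ "Suc (Max D)"]) auto
qed

text \<open>\<open>X\<close> meets the chain of \<open>t\<close> in the initial piece from
  \<open>p\<close> to \<open>t\<close>, so complementing inside the chain gives a terminal piece.
  The defect is that a predecessor of \<open>p\<close> is in \<open>Z\<close> and \<open>p\<close>
  is not. The last clause lists where closure of \<open>Z\<close> under \<open>g\<close> can fail,
  so that the defect can be located from \<open>Z\<close>.\<close>

lemma rooted_off_cycle:
  assumes r: "rooted t X" and t: "t \<notin> C" and nX: "\<not> X \<subseteq> chain (head t)"
  defines "p \<equiv> head t" and "Z \<equiv> (X - chain (head t)) \<union> (chain (head t) - X)"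
  shows "p \<in> N - C" "Z \<in> chain_closed {root t}" "p \<notin> Z" "\<exists>q\<in>Z. g q = p"
    "\<And>z. z \<in> Z \<Longrightarrow> g z \<in> Z \<or> g z \<in> C \<or> g z = p \<or> g z = (g ^^ len p) p"
proof -
  have XV: "X \<subseteq> V" and tX: "t \<in> X" and clo: "\<And>v. v \<in> X \<Longrightarrow> v \<noteq> t \<Longrightarrow> g v \<in> X"
    and rch: "\<And>v. v \<in> X \<Longrightarrow> \<exists>i. (g ^^ i) v = t"
    using r unfolding rooted_def by auto
  have tV: "t \<in> V - C" using XV tX t by blast
  show pN: "p \<in> N - C" using head_off_C tV unfolding p_def by blast
  have tp: "t \<in> chain p" using head_off_C tV unfolding p_def by blast
  have Z: "Z = (X - chain p) \<union> (chain p - X)" by (simp add: Z_def p_def)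
  have XC: "X \<inter> C = {}"
    using rch funpow_in_C t by blast
  have ent: "g z = p" if "z \<in> V" "z \<notin> chain p" "g z \<in> chain p" for z
    using chain_pred[of p z] pN that by blast
  \<comment> \<open>Following a vertex of \<open>X\<close> outside the chain towards
    \<open>t\<close> exhibits an edge by which \<open>X\<close> enters the chain, necessarily at
    \<open>p\<close>.\<close>
  have "\<exists>q\<in>X - chain p. g q \<in> chain p \<and> g q \<in> X"
  proof -
    obtain y where y: "y \<in> X" "y \<notin> chain p" using nX unfolding p_def by blast
    obtain k where "(g ^^ k) y = t" using rch y by blast
    then show ?thesis using y
    proof (induction k arbitrary: y)
      case 0 then show ?case using tp by simp
    next
      case (Suc k)
      have "y \<noteq> t" using tp Suc.prems by blast
      then have "g y \<in> X" using clo Suc.prems by blast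
      then show ?case using Suc by (cases "g y \<in> chain p") (auto simp: funpow_swap1)
    qed
  qed
  then obtain q where q: "q \<in> X" "q \<notin> chain p" "g q = p" "p \<in> X" using ent XV by blast
  have pc: "p \<in> chain p" using v_in_chain pN by blast
  show "p \<notin> Z" using pc q Z by blast
  show "\<exists>q\<in>Z. g q = p" using q Z by blast
  obtain b where b: "b < len p" "t = (g ^^ b) p" using tp unfolding chain_def by blast
  have pre: "(g ^^ i) p \<in> X" if "i \<le> b" for i
    using that
  proof (induction i)
    case (Suc i)
    have "(g ^^ i) p \<noteq> t" using chain_inj[of p p i b] Suc.prems b pN by auto
    then show ?case using clo Suc by simp
  qed (use q in simp)
  \<comment> \<open>By \<open>pre\<close> a chain vertex missing from \<open>X\<close> comes after
    \<open>t\<close>. No later vertex is in \<open>X\<close> either, since it would have to lead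
    back to \<open>t\<close>; so the complement runs to the end of the chain.\<close>
  have post: "g z \<in> chain p - X \<or> g z = (g ^^ len p) p" if z: "z \<in> chain p" "z \<notin> X" for z
  proof -
    obtain j where j: "j < len p" "z = (g ^^ j) p" using z unfolding chain_def by blast
    have jb: "b < j" using pre[of j] z j by (metis linorder_not_less)
    show ?thesis
    proof (cases "Suc j < len p")
      case True
      then have "(g ^^ Suc j) p \<in> chain p" unfolding chain_def by blast
      then have gz: "g z = (g ^^ Suc j) p" "g z \<in> chain p" using j by simp_all
      have "g z \<notin> X"
      proof
        assume "g z \<in> X"
        then obtain k where "(g ^^ k) (g z) = t" using rch by blast
        moreover have "(g ^^ (Suc j - b)) t = g z"
          using funpow_diff[of b "Suc j" p] gz(1) jb b(2) by simp
        ultimately have "t = g z" using acyclic_off_C tV by blast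
        then show False using chain_inj[of p p b "Suc j"] b gz True jb pN by auto
      qed
      then show ?thesis using gz by blast
    next
      case False
      then have "len p = Suc j" using j by simp
      then show ?thesis using j by simp
    qed
  qed
  have inX: "g z \<in> X - chain p \<or> g z = p" if "z \<in> X" "z \<notin> chain p" for z
  proof -
    have "g z \<in> X" using clo that tp by blast
    then show ?thesis using ent XV that by blast
  qed
  show bd: "g z \<in> Z \<or> g z \<in> C \<or> g z = p \<or> g z = (g ^^ len p) p" if "z \<in> Z" for z
    using that inX post unfolding Z by blast
  have lN: "(g ^^ len p) p \<in> N" using len_N pN by blast
  have "g z \<in> Z" if "z \<in> Z" "g z \<notin> N" for z
    using that inX post lN pN unfolding Z by (metis DiffD1 UnE UnI1 UnI2 DiffI DiffE)
  moreover have "z \<in> V - C \<and> root z = root t" if "z \<in> Z" for z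
  proof (cases "z \<in> chain p")
    case True
    then show ?thesis
      using root_chain[OF pN] tp chain_off_C[OF pN] chain_subset pN by auto
  next
    case False
    then have "z \<in> X" using that Z by blast
    then show ?thesis using rch root_funpow t XV XC by blast
  qed
  ultimately show "Z \<in> chain_closed {root t}" unfolding chain_closed_def by blast
qed

text \<open>A subtree whose sink lies on the cycle is encoded by its trace on the cycle and the rest.
  If the sink \<open>t\<close> is off the cycle, complementing the subtree inside the chain of \<open>t\<close> gives a
  chain-closed set with a defect at the head of this chain; the defect makes it
  different from the first kind and determines the chain.\<close>

lemma card_non_intervals:
  "card {(t, X). rooted t X \<and> \<not> (\<exists>v\<in>N - C. X \<subseteq> chain v)}
    \<le> (\<Sum>x\<in>C. \<Sum>n\<in>{1..period}. arc_wt x n)"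
proof -
  define R where "R = {(t, X). rooted t X \<and> \<not> (\<exists>v\<in>N - C. X \<subseteq> chain v)}"
  define D where "D = (SIGMA w:C \<times> {1..period}. chain_closed (arc (fst w) (snd w)))"
  \<comment> \<open>The premises stand inside the existential so that \<open>win\<close> can be
    chosen as a total function.\<close>
  have "\<exists>w. t \<in> C \<longrightarrow> rooted t X \<longrightarrow> w \<in> C \<times> {1..period} \<and> X \<inter> C = arc (fst w) (snd w)
      \<and> t = (g ^^ (snd w - 1)) (fst w)" for t X
    using rooted_on_cycle[of t X] by fastforce
  then obtain win where win: "\<And>t X. t \<in> C \<Longrightarrow> rooted t X \<Longrightarrow> win t X \<in> C \<times> {1..period}
      \<and> X \<inter> C = arc (fst (win t X)) (snd (win t X)) \<and> t = (g ^^ (snd (win t X) - 1)) (fst (win t X))"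
    by metis
  define Y where "Y t X = (X - chain (head t)) \<union> (chain (head t) - X)" for t X
  \<comment> \<open>With the sink off the cycle, \<open>X\<close> avoids the cycle, so the arc
    component is free to record \<open>root t\<close> as an arc of length 1.\<close>
  define f where "f = (\<lambda>(t, X). if t \<in> C then (win t X, X - C) else ((root t, 1), Y t X))"
  have off: "\<not> X \<subseteq> chain (head t)" if "(t, X) \<in> R" "t \<notin> C" for t X
    using that head_off_C[of t] unfolding R_def rooted_def by blast
  have rt: "rooted t X" if "(t, X) \<in> R" for t X using that unfolding R_def by simp
  have inD: "f (t, X) \<in> D" if tX: "(t, X) \<in> R" for t X
  proof -
    note r = rt[OF tX]
    show ?thesis
    proof (cases "t \<in> C")
      case True
      note w = win[OF True r]
      have "X - C \<in> chain_closed (arc (fst (win t X)) (snd (win t X)))"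
      proof -
        have "v \<in> V - C \<and> root v \<in> X \<inter> C" if "v \<in> X - C" for v
          using that root_rooted[OF r True] root_in r unfolding rooted_def by blast
        moreover have "g v \<in> X - C" if "v \<in> X - C" "g v \<notin> N" for v
        proof -
          have "v \<noteq> t" "v \<in> V - C" using that True r unfolding rooted_def by blast+
          then have "g v \<in> X" "g v \<notin> C" using that enter_C[of v] r unfolding rooted_def by blast+
          then show ?thesis by blast
        qed
        ultimately show ?thesis using w unfolding chain_closed_def by blast
      qed
      then show ?thesis using w True unfolding f_def D_def by (simp add: mem_Sigma_iff)
    next
      case False
      have "arc (root t) 1 = {root t}" by (simp add: arc_def lessThan_Suc)
      moreover have "root t \<in> C" using root_in r unfolding rooted_def by blast
      moreover have "Y t X \<in> chain_closed {root t}"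
        using rooted_off_cycle(2)[OF r False off[OF tX False]] by (simp add: Y_def)
      ultimately show ?thesis using False period_ge3 unfolding f_def D_def by simp
    qed
  qed
  have "f ` R \<subseteq> D" using inD by auto
  moreover have "inj_on f R"
  proof -
    \<comment> \<open>\<open>X - C\<close> contains the image under \<open>g\<close> of each of its
      members unless that image is on the cycle, whereas \<open>Y t' X'\<close> contains a
      predecessor of \<open>head t'\<close> without \<open>head t'\<close> itself.\<close>
    have mixed: "False" if a: "(t, X) \<in> R" "(t', X') \<in> R" "t \<in> C" "t' \<notin> C" "f (t, X) = f (t', X')" for t X t' X'
    proof -
      note o = rooted_off_cycle[OF rt[OF a(2)] a(4) off[OF a(2) a(4)], folded Y_def]
      have eq: "X - C = Y t' X'" using a by (simp add: f_def)
      obtain q where q: "q \<in> Y t' X'" "g q = head t'" using o(4) by blast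
      then have "q \<in> X" "q \<noteq> t" using eq a(3) by blast+
      then have "g q \<in> X" using rt[OF a(1)] unfolding rooted_def by blast
      then have "head t' \<in> X - C" using q(2) o(1) by simp
      then show False using o(3) eq by simp
    qed
    have both: "t = t' \<and> X = X'"
      if a: "(t, X) \<in> R" "(t', X') \<in> R" "t \<notin> C" "t' \<notin> C" "f (t, X) = f (t', X')" for t X t' X'
    proof -
      note o = rooted_off_cycle[OF rt[OF a(1)] a(3) off[OF a(1) a(3)], folded Y_def]
      note o' = rooted_off_cycle[OF rt[OF a(2)] a(4) off[OF a(2) a(4)], folded Y_def]
      have eq: "Y t X = Y t' X'" using a by (simp add: f_def)
      define p where "p = head t"
      define p' where "p' = head t'"
      \<comment> \<open>The defect at \<open>p\<close> must be at a place allowed by the encoding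
        with head \<open>p'\<close>: at \<open>p'\<close> itself or at the end of its chain.
        Exchanging the roles, \<open>p \<noteq> p'\<close> would produce a cycle outside
        \<open>C\<close>.\<close>
      have 1: "p = p' \<or> p = (g ^^ len p') p'" using o o' eq unfolding p_def p'_def by (metis DiffD2)
      have 2: "p' = p \<or> p' = (g ^^ len p) p" using o o' eq unfolding p_def p'_def by (metis DiffD2)
      have pp: "p = p'"
      proof (rule ccontr)
        assume ne: "p \<noteq> p'"
        have "p \<in> V - C" using o(1) N_subset unfolding p_def by blast
        moreover have "(g ^^ len p) p = p'" "(g ^^ len p') p' = p" using 1 2 ne by auto
        ultimately show False using acyclic_off_C[of p "len p" p' "len p'"] ne by blast
      qed
      \<comment> \<open>Symmetric difference with a fixed chain can be undone, so \<open>X\<close>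
        is recovered.\<close>
      then have e: "(X - chain p) \<union> (chain p - X) = (X' - chain p) \<union> (chain p - X')"
        using eq unfolding Y_def p_def p'_def by simp
      have XX: "X = X'"
      proof (rule set_eqI)
        show "x \<in> X \<longleftrightarrow> x \<in> X'" for x using eqset_imp_iff[OF e, of x] by blast
      qed
      have "t \<in> X" "t' \<in> X" using rt[OF a(1)] rt[OF a(2)] XX unfolding rooted_def by auto
      moreover have "t \<in> V - C" using a rt[OF a(1)] unfolding rooted_def by blast
      moreover have "\<exists>i. (g ^^ i) t = t'" "\<exists>i. (g ^^ i) t' = t"
        using rt[OF a(1)] rt[OF a(2)] XX \<open>t \<in> X\<close> \<open>t' \<in> X\<close> unfolding rooted_def by blast+
      ultimately show ?thesis using acyclic_off_C XX by blast
    qed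
    have cyc: "t = t' \<and> X = X'"
      if a: "(t, X) \<in> R" "(t', X') \<in> R" "t \<in> C" "t' \<in> C" "f (t, X) = f (t', X')" for t X t' X'
    proof -
      have eq: "win t X = win t' X'" "X - C = X' - C" using a by (simp_all add: f_def)
      note w = win[OF a(3) rt[OF a(1)]] and w' = win[OF a(4) rt[OF a(2)]]
      have "t = t'" using w w' eq by metis
      moreover have "X \<inter> C = X' \<inter> C" using w w' eq by metis
      ultimately show ?thesis using eq by blast
    qed
    show ?thesis
    proof (rule inj_onI)
      fix u u' assume h: "u \<in> R" "u' \<in> R" "f u = f u'"
      obtain t X t' X' where "u = (t, X)" "u' = (t', X')" by (metis surj_pair)
      note R = h(1,2)[unfolded this] and f = h(3)[unfolded this]
      have "t = t' \<and> X = X'"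
      proof (cases "t \<in> C")
        case True
        then have "t' \<in> C" using mixed[OF R True _ f] by blast
        then show ?thesis using cyc[OF R True _ f] by blast
      next
        case False
        then have "t' \<notin> C" using mixed[OF R(2,1) _ False f[symmetric]] by blast
        then show ?thesis using both[OF R False _ f] by blast
      qed
      then show "u = u'" using \<open>u = (t, X)\<close> \<open>u' = (t', X')\<close> by simp
    qed
  qed
  moreover have "finite D" unfolding D_def using finC finite_chain_closed by blast
  ultimately have "card R \<le> card D" by (intro card_inj_on_le)
  also have "card D = (\<Sum>w\<in>C \<times> {1..period}. card (chain_closed (arc (fst w) (snd w))))"
    unfolding D_def using finC finite_chain_closed by (intro card_SigmaI) auto
  also have "\<dots> \<le> (\<Sum>w\<in>C \<times> {1..period}. arc_wt (fst w) (snd w))"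
    by (intro sum_mono card_chain_closed_arc) auto
  also have "\<dots> = (\<Sum>x\<in>C. \<Sum>n\<in>{1..period}. arc_wt x n)"
    by (simp add: sum.cartesian_product case_prod_unfold)
  finally show ?thesis by (simp add: R_def)
qed

section \<open>Total weight of the arcs\<close>

lemma wt_pos: "0 < wt w"
  unfolding wt_def by (intro prod_pos) simp

text \<open>A cycle vertex in \<open>N\<close> has, besides its predecessor on the cycle, one off
  it; the segment arriving there contributes a factor \<open>len + 1 \<ge> 2\<close>.\<close>

lemma wt_ge_2: "w \<in> N \<inter> C \<Longrightarrow> 2 \<le> wt w"
proof -
  assume w: "w \<in> N \<inter> C"
  have "w \<in> g ` C" using bij_funpow_C[of 1] w by (simp add: bij_betw_def)
  then obtain z where z: "z \<in> C" "g z = w" by blast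
  have "\<exists>u\<in>V - C. g u = w"
  proof (rule ccontr)
    assume "\<not> ?thesis"
    then have "preds w = {z}" using z C_subset inj_on_g_C unfolding preds_def inj_on_def by blast
    then show False using w unfolding N_def by simp
  qed
  then obtain u where u: "u \<in> V - C" "g u = w" by blast
  have "head u \<in> N - C" using head_off_C u by blast
  moreover have "root (head u) = w"
    using root_chain[OF calculation, of u] head_off_C[of u] u root_g[of u] root_C[of w] w by auto
  ultimately have "(len (head u) + 1) dvd wt w"
    unfolding wt_def using finN by (intro dvd_prodI) auto
  then have "len (head u) + 1 \<le> wt w" using wt_pos dvd_imp_le by blast
  moreover have "0 < len (head u)" using len_N \<open>head u \<in> N - C\<close> by blast
  ultimately show ?thesis by simp
qed

lemma arc_wt_add: "arc_wt x (m + n) = arc_wt x m * arc_wt ((g ^^ m) x) n"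
  unfolding arc_wt_def
  by (induction n) (simp_all add: funpow_add funpow_swap1 ac_simps)

lemma arc_wt_period: "x \<in> C \<Longrightarrow> arc_wt x period = (\<Prod>v\<in>N - C. len v + 1)"
proof -
  assume x: "x \<in> C"
  have "{v \<in> N - C. root v \<in> C} = N - C" using root_in N_subset by blast
  then show ?thesis using prod_arc[OF x, of period] arc_full[OF x] prod_wt[OF finC] by simp
qed

text \<open>By \<open>wt_ge_2\<close> an arc of weight 1 avoids \<open>N\<close>, so it is a subpath
  of the \<open>len v - 1\<close> inner vertices of one segment on the cycle.\<close>

lemma card_unit_arcs:
  assumes "N \<noteq> {}"
  shows "card {(x, n). x \<in> C \<and> 1 \<le> n \<and> n < period \<and> arc_wt x n = 1} \<le> (\<Sum>v\<in>N \<inter> C. triangle (len v - 1))"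
proof -
  define I where "I = (SIGMA v:N \<inter> C. SIGMA b:{..<len v - 1}. {..b})"
  \<comment> \<open>\<open>b\<close> counts from the end of the chain and \<open>Suc a\<close> is
    the number of vertices. The position \<open>len v - 1 - b\<close> is at least 1, which avoids
    the start \<open>v \<in> N\<close>.\<close>
  define f where "f = (\<lambda>(v, b, a). ((g ^^ (len v - 1 - b)) v, Suc a))"
  have "{(x, n). x \<in> C \<and> 1 \<le> n \<and> n < period \<and> arc_wt x n = 1} \<subseteq> f ` I"
  proof clarify
    fix x n assume x: "x \<in> C" and n: "1 \<le> n" "n < period" and one: "arc_wt x n = 1"
    have nN: "(g ^^ i) x \<notin> N" if "i < n" for i
    proof
      assume "(g ^^ i) x \<in> N"
      then have "2 \<le> wt ((g ^^ i) x)" using x funpow_in_C wt_ge_2 by blast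
      moreover have "wt ((g ^^ i) x) dvd arc_wt x n" unfolding arc_wt_def using that by (intro dvd_prodI) auto
      ultimately show False using one by simp
    qed
    define v where "v = head x"
    have v: "v \<in> N" "x \<in> chain v" using head_in[OF assms] x C_subset unfolding v_def by auto
    then have "v \<in> C" using chain_off_C x by blast
    obtain j where j: "j < len v" "x = (g ^^ j) v" using v unfolding chain_def by blast
    have "j \<noteq> 0"
    proof
      assume "j = 0"
      then have "x = v" using j by simp
      then show False using nN[of 0] n v by simp
    qed
    have jn: "j + n \<le> len v"
    proof (rule ccontr)
      assume "\<not> ?thesis"
      then have "len v - j < n" using j(1) by linarith
      then have "(g ^^ (len v - j)) x \<notin> N" using nN by simp
      moreover have "(g ^^ (len v - j)) x = (g ^^ len v) v"
        using funpow_diff[of j "len v" v] j by simp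
      ultimately show False using len_N v by auto
    qed
    have "(x, n) = f (v, len v - 1 - j, n - 1)" using j n \<open>j \<noteq> 0\<close> by (simp add: f_def)
    moreover have "(v, len v - 1 - j, n - 1) \<in> I"
      using v \<open>v \<in> C\<close> \<open>j \<noteq> 0\<close> j jn n by (auto simp: I_def)
    ultimately show "(x, n) \<in> f ` I" by (rule image_eqI)
  qed
  moreover have finI: "finite I" using finN by (auto simp: I_def)
  ultimately have "card {(x, n). x \<in> C \<and> 1 \<le> n \<and> n < period \<and> arc_wt x n = 1} \<le> card I"
    by (meson card_image_le card_mono finite_imageI order_trans)
  also have "card I = (\<Sum>v\<in>N \<inter> C. triangle (len v - 1))"
    unfolding I_def using finN by (subst card_SigmaI) (auto simp: card_ordered_pairs)
  finally show ?thesis .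
qed

lemma sum_funpow_C: "(\<Sum>x\<in>C. h ((g ^^ n) x)) = (\<Sum>x\<in>C. h x)"
  using sum.reindex_bij_betw[OF bij_funpow_C] by blast

text \<open>The \<open>c\<close> full arcs weigh \<open>P\<close> each. Every other arc is paired
  with its complement; their weights multiply to \<open>P\<close>, so they add up to at most
  \<open>P\<close>, plus 1 for each weight equal to 1.\<close>

lemma sum_arc_wt:
  assumes "N \<noteq> {}"
  shows "2 *(\<Sum>x\<in>C. \<Sum>n\<in>{1..period}. arc_wt x n)
    \<le> period * (period + 1) * (\<Prod>v\<in>N - C. len v + 1) + 2 * (\<Sum>v\<in>N \<inter> C. triangle (len v - 1))"
proof -
  define P where "P = (\<Prod>v\<in>N - C. len v + 1)"
  define c where "c = period"
  define one where "one x n = (if arc_wt x n = 1 then 1 else 0 :: nat)" for x n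
  have c: "1 \<le> c" using period_ge3 by (simp add: c_def)
  have Ppos: "0 < P" unfolding P_def by (intro prod_pos) simp
  have flip: "(\<Sum>n\<in>{1..<c}. h (c - n)) = (\<Sum>n\<in>{1..<c}. h n)" for h :: "nat \<Rightarrow> nat"
    by (rule sum.reindex_bij_witness[of _ "\<lambda>n. c - n" "\<lambda>n. c - n"]) auto
  \<comment> \<open>Passing to the complement permutes the proper arcs, so a sum over complements
    equals the sum over arcs.\<close>
  have compl: "(\<Sum>n\<in>{1..<c}. \<Sum>x\<in>C. h ((g ^^ n) x) (c - n)) = (\<Sum>n\<in>{1..<c}. \<Sum>x\<in>C. h x n)"
    for h :: "'a \<Rightarrow> nat \<Rightarrow> nat"
  proof -
    have "(\<Sum>n\<in>{1..<c}. \<Sum>x\<in>C. h ((g ^^ n) x) (c - n)) = (\<Sum>n\<in>{1..<c}. \<Sum>x\<in>C. h x (c - n))"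
      by (intro sum.cong refl sum_funpow_C)
    then show ?thesis using flip[of "\<lambda>n. \<Sum>x\<in>C. h x n"] by simp
  qed
  define S where "S = (\<Sum>n\<in>{1..<c}. \<Sum>x\<in>C. arc_wt x n)"
  define O1 where "O1 = (\<Sum>n\<in>{1..<c}. \<Sum>x\<in>C. one x n)"
  have "2 * S = (\<Sum>n\<in>{1..<c}. \<Sum>x\<in>C. arc_wt x n + arc_wt ((g ^^ n) x) (c - n))"
    using compl[of arc_wt] by (simp add: sum.distrib S_def)
  also have "\<dots> \<le> (\<Sum>n\<in>{1..<c}. \<Sum>x\<in>C. P + one x n + one ((g ^^ n) x) (c - n))"
  proof (intro sum_mono)
    fix n x assume "n \<in> {1..<c}" "x \<in> C"
    then have "arc_wt x n * arc_wt ((g ^^ n) x) (c - n) = P"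
      using arc_wt_add[of x n "c - n"] arc_wt_period[of x] by (simp add: c_def P_def)
    then show "arc_wt x n + arc_wt ((g ^^ n) x) (c - n) \<le> P + one x n + one ((g ^^ n) x) (c - n)"
      unfolding one_def using add_le_of_mult_eq Ppos by blast
  qed
  also have "\<dots> = (c - 1) * (c * P) + 2 * O1"
    using compl[of one] by (simp add: sum.distrib O1_def card_C c_def)
  finally have S: "2 * S \<le> (c - 1) * (c * P) + 2 * O1" .
  have "O1 = (\<Sum>w\<in>{1..<c} \<times> C. one (snd w) (fst w))"
    unfolding O1_def by (simp add: sum.cartesian_product case_prod_unfold)
  also have "\<dots> = card {w \<in> {1..<c} \<times> C. arc_wt (snd w) (fst w) = 1}"
    unfolding one_def using finC by (simp add: sum.If_cases Int_def)
  also have "\<dots> = card (prod.swap ` {w \<in> {1..<c} \<times> C. arc_wt (snd w) (fst w) = 1})"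
    by (simp add: card_image)
  also have "prod.swap ` {w \<in> {1..<c} \<times> C. arc_wt (snd w) (fst w) = 1}
      = {(x, n). x \<in> C \<and> 1 \<le> n \<and> n < period \<and> arc_wt x n = 1}"
    by (auto simp: c_def image_iff)
  finally have O1: "O1 \<le> (\<Sum>v\<in>N \<inter> C. triangle (len v - 1))" using card_unit_arcs[OF assms] by simp
  have "(\<Sum>x\<in>C. \<Sum>n\<in>{1..period}. arc_wt x n) = (\<Sum>n\<in>{1..c}. \<Sum>x\<in>C. arc_wt x n)"
    unfolding c_def by (rule sum.swap)
  also have "{1..c} = insert c {1..<c}" using c by auto
  also have "(\<Sum>n\<in>insert c {1..<c}. \<Sum>x\<in>C. arc_wt x n) = (\<Sum>x\<in>C. arc_wt x c) + S"
    by (simp add: S_def)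
  also have "(\<Sum>x\<in>C. arc_wt x c) = c * P"
    using arc_wt_period card_C by (simp add: c_def P_def)
  finally have "2 * (\<Sum>x\<in>C. \<Sum>n\<in>{1..period}. arc_wt x n) = 2 * (c * P) + 2 * S" by simp
  also have "\<dots> \<le> 2 * (c * P) + (c - 1) * (c * P) + 2 * O1" using S by simp
  also have "2 * (c * P) + (c - 1) * (c * P) = c * (c + 1) * P"
    using c by (cases c) (simp_all add: algebra_simps)
  finally show ?thesis using O1 by (simp add: c_def P_def)
qed

text \<open>Writing \<open>triangle (len v - 1)\<close> as \<open>triangle (len v) - len v\<close>
  treats segments on and off the cycle alike; the subtracted lengths add up to the cycle length,
  which is the term \<open>2 * period\<close>.\<close>

lemma card_rooted_le:
  assumes "N \<noteq> {}"
  shows "2 * card {(t, X). rooted t X} + 2 * period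
    \<le> 2 * (\<Sum>v\<in>N. triangle (len v)) + period * (period + 1) * (\<Prod>v\<in>N - C. len v + 1)"
proof -
  define A where "A = {(t, X). rooted t X \<and> (\<exists>v\<in>N - C. X \<subseteq> chain v)}"
  define B where "B = {(t, X). rooted t X \<and> \<not> (\<exists>v\<in>N - C. X \<subseteq> chain v)}"
  have "{(t, X). rooted t X} = A \<union> B" unfolding A_def B_def by blast
  then have "card {(t, X). rooted t X} \<le> card A + card B" by (simp add: card_Un_le)
  also have "\<dots> \<le> (\<Sum>v\<in>N - C. triangle (len v)) + (\<Sum>x\<in>C. \<Sum>n\<in>{1..period}. arc_wt x n)"
    using card_intervals card_non_intervals unfolding A_def B_def by (rule add_mono)
  finally have 1: "2 * card {(t, X). rooted t X} \<le> 2 * (\<Sum>v\<in>N - C. triangle (len v))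
      + period * (period + 1) * (\<Prod>v\<in>N - C. len v + 1) + 2 * (\<Sum>v\<in>N \<inter> C. triangle (len v - 1))"
    using sum_arc_wt[OF assms] by linarith
  have "(\<Sum>v\<in>N \<inter> C. triangle (len v)) = (\<Sum>v\<in>N \<inter> C. triangle (len v - 1) + len v)"
  proof (rule sum.cong[OF refl])
    fix v assume "v \<in> N \<inter> C"
    then have "0 < len v" using len_N by blast
    then show "triangle (len v) = triangle (len v - 1) + len v"
      using triangle_Suc[of "len v - 1"] by simp
  qed
  then have 2: "(\<Sum>v\<in>N \<inter> C. triangle (len v)) = (\<Sum>v\<in>N \<inter> C. triangle (len v - 1)) + period"
    by (simp add: sum.distrib period_sum[OF assms])
  have 3: "(\<Sum>v\<in>N. triangle (len v)) = (\<Sum>v\<in>N \<inter> C. triangle (len v)) + (\<Sum>v\<in>N - C. triangle (len v))"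
    using sum.Int_Diff[OF finN] by blast
  show ?thesis using 1 2 3 by linarith
qed

end

subsection \<open>The extremal graph\<close>

text \<open>The orientation of the extremal graph with cycle length \<open>n\<close>: round the
  cycle by increasing index, and down each pendent path to \<open>(0, 0)\<close>.\<close>

definition lollipop_next :: "nat \<Rightarrow> nat \<times> nat \<Rightarrow> nat \<times> nat" where
  "lollipop_next n v = (if fst v = 0 then (0, (snd v + 1) mod n)
    else if snd v \<le> 1 then (0, 0) else (fst v, snd v - 1))"

lemma lollipop_next_cycle: "i < n \<Longrightarrow> (lollipop_next n ^^ k) (0, i) = (0, (i + k) mod n)"
  by (induction k) (simp_all add: lollipop_next_def mod_Suc_eq)

lemma lollipop_next_path: "0 < j \<Longrightarrow> k < t \<Longrightarrow> (lollipop_next n ^^ k) (j, t) = (j, t - k)"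
  by (induction k) (simp_all add: lollipop_next_def)

lemma lollipop_next_path_end: "0 < j \<Longrightarrow> 0 < t \<Longrightarrow> (lollipop_next n ^^ t) (j, t) = (0, 0)"
proof -
  assume "0 < j" "0 < t"
  then have "(lollipop_next n ^^ (t - 1)) (j, t) = (j, 1)" using lollipop_next_path[of j "t - 1" t] by simp
  moreover have "(lollipop_next n ^^ t) (j, t) = lollipop_next n ((lollipop_next n ^^ (t - 1)) (j, t))"
    using \<open>0 < t\<close> by (cases t) simp_all
  ultimately show ?thesis using \<open>0 < j\<close> by (simp add: lollipop_next_def)
qed

lemma lollipop_reach_cycle: "i < n \<Longrightarrow> d < n \<Longrightarrow> \<exists>k. (lollipop_next n ^^ k) (0, i) = (0, d)"
  using lollipop_next_cycle[of i n "n - i + d"] by (intro exI[of _ "n - i + d"]) simp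

lemma lollipop_reach_path:
  "0 < j \<Longrightarrow> 0 < t \<Longrightarrow> d < n \<Longrightarrow> \<exists>k. (lollipop_next n ^^ k) (j, t) = (0, d)"
proof -
  assume h: "0 < j" "0 < t" "d < n"
  obtain k where "(lollipop_next n ^^ k) (0, 0) = (0, d)" using lollipop_reach_cycle[of 0 n d] h by auto
  then have "(lollipop_next n ^^ (k + t)) (j, t) = (0, d)"
    using lollipop_next_path_end[OF h(1,2)] by (simp add: funpow_add)
  then show ?thesis by blast
qed

lemma mod_succ_neq: "i < n \<Longrightarrow> 2 \<le> n \<Longrightarrow> (i + 1) mod n \<noteq> (i :: nat)"
  by (simp add: mod_if)

lemma mod_succ2_neq: "i < n \<Longrightarrow> 3 \<le> n \<Longrightarrow> ((i + 1) mod n + 1) mod n \<noteq> (i :: nat)"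
  by (simp add: mod_if)

lemma U1_V_cases:
  "v \<in> U1_V L \<longleftrightarrow> (fst v = 0 \<and> snd v < hd L)
    \<or> (1 \<le> fst v \<and> fst v < length L \<and> 1 \<le> snd v \<and> snd v \<le> L ! fst v)"
  by (cases v) (auto simp: U1_V_def)

lemma U1_functional_graph:
  assumes "3 \<le> hd L"
  shows "functional_graph (U1_V L) (lollipop_next (hd L)) (0, 0)"
proof
  have "U1_V L \<subseteq> ({0} \<times> {..<hd L}) \<union> (SIGMA j:{..<length L}. {..L ! j})"
    by (auto simp: U1_V_def)
  then show "finite (U1_V L)" by (rule finite_subset) simp
  show "(0, 0) \<in> U1_V L" using assms by (auto simp: U1_V_def)
  fix v assume v: "v \<in> U1_V L"
  then show "lollipop_next (hd L) v \<in> U1_V L"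
    using assms by (auto simp: U1_V_cases lollipop_next_def)
  show "lollipop_next (hd L) v \<noteq> v"
    using v assms mod_succ_neq[of "snd v" "hd L"]
    by (cases v) (auto simp: U1_V_cases lollipop_next_def)
  show "lollipop_next (hd L) (lollipop_next (hd L) v) \<noteq> v"
    using v assms mod_succ2_neq[of "snd v" "hd L"]
    by (cases v) (auto simp: U1_V_cases lollipop_next_def)
  show "\<exists>i. (lollipop_next (hd L) ^^ i) v = (0, 0)"
    using v assms lollipop_reach_cycle[of "snd v" "hd L" 0] lollipop_reach_path[of "fst v" "snd v" 0 "hd L"]
    by (cases v) (auto simp: U1_V_cases)
qed

lemma U1_edges:
  assumes "3 \<le> hd L"
  shows "functional_graph.edges (U1_V L) (lollipop_next (hd L)) = U1_E L"
proof -
  interpret functional_graph "U1_V L" "lollipop_next (hd L)" "(0, 0)"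
    by (rule U1_functional_graph[OF assms])
  have e0: "edge (0, i) = {(0, i), (0, (i + 1) mod hd L)}" for i
    by (simp add: edge_def lollipop_next_def)
  have e1: "edge (j, 1) = {(0, 0), (j, 1)}" if "1 \<le> j" for j
    using that by (auto simp: edge_def lollipop_next_def)
  have e2: "edge (j, t + 1) = {(j, t), (j, t + 1)}" if "1 \<le> j" "1 \<le> t" for j t
    using that by (auto simp: edge_def lollipop_next_def)
  show ?thesis
  proof
    show "edges \<subseteq> U1_E L"
    proof
      fix e assume "e \<in> edges"
      then obtain a i where v: "(a, i) \<in> U1_V L" "e = edge (a, i)" unfolding edges_def by auto
      show "e \<in> U1_E L"
      proof (cases "a = 0")
        case True
        then show ?thesis using v e0 by (auto simp: U1_V_cases U1_E_def)
      next
        case False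
        then have a: "1 \<le> a" "a < length L" "1 \<le> i" "i \<le> L ! a" using v by (auto simp: U1_V_cases)
        show ?thesis
        proof (cases "i = 1")
          case True
          then have "e = {(0, 0), (a, 1)}" using v e1 a by simp
          then show ?thesis using a True unfolding U1_E_def by blast
        next
          case False
          then have "e = {(a, i - 1), (a, i - 1 + 1)}" using v e2[of a "i - 1"] a by simp
          moreover have "1 \<le> i - 1" "i - 1 < L ! a" using False a by auto
          ultimately show ?thesis using a unfolding U1_E_def by blast
        qed
      qed
    qed
    show "U1_E L \<subseteq> edges"
    proof
      fix e assume "e \<in> U1_E L"
      then consider i where "i < hd L" "e = {(0, i), (0, (i + 1) mod hd L)}"
        | j where "1 \<le> j" "j < length L" "1 \<le> L ! j" "e = {(0, 0), (j, 1)}"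
        | j t where "1 \<le> j" "j < length L" "1 \<le> t" "t < L ! j" "e = {(j, t), (j, t + 1)}"
        unfolding U1_E_def by blast
      then show "e \<in> edges"
      proof cases
        case 1
        then show ?thesis unfolding edges_def by (intro image_eqI[of _ _ "(0, i)"]) (auto simp: e0 U1_V_cases)
      next
        case 2
        then show ?thesis unfolding edges_def
          by (intro image_eqI[of _ _ "(j, 1)"]) (auto simp: e1[simplified] U1_V_cases)
      next
        case 3
        then show ?thesis unfolding edges_def
          by (intro image_eqI[of _ _ "(j, t + 1)"]) (auto simp: e2[simplified] U1_V_cases)
      qed
    qed
  qed
qed

text \<open>Three disjoint families are exhibited: \<open>I1\<close> for subtrees through
  \<open>(0, 0)\<close>, \<open>I2\<close> for subpaths of the cycle avoiding it, and
  \<open>I3\<close> for subpaths of a pendent path avoiding it. The final 1 is the empty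
  subtree.\<close>

lemma U1_num_subtrees_ge:
  assumes l: "3 \<le> hd L"
  shows "triangle (hd L) * (\<Prod>j\<in>{1..<length L}. L ! j + 1) + triangle (hd L - 1)
      + (\<Sum>j\<in>{1..<length L}. triangle (L ! j)) + 1 \<le> num_subtrees (U1_V L) (U1_E L)"
proof -
  interpret functional_graph "U1_V L" "lollipop_next (hd L)" "(0, 0)"
    by (rule U1_functional_graph[OF l])
  define n where "n = hd L"
  define m where "m = length L"
  have n3: "3 \<le> n" using l n_def by simp
  define I1 where "I1 = (SIGMA b:{..<n}. {..b}) \<times> (\<Pi>\<^sub>E j\<in>{1..<m}. {..L ! j})"
  define I2 where "I2 = (SIGMA b:{..<n - 1}. {..b})"
  define I3 where "I3 = (SIGMA j:{1..<m}. SIGMA b:{..<L ! j}. {..b})"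
  \<comment> \<open>From the cycle this takes the vertices from 0 up to the sink
    \<open>n - 1 - b\<close> and the last \<open>a\<close> ones, and from pendent path
    \<open>j\<close> the first \<open>k j\<close>. For \<open>a = b\<close> all cycle vertices
    occur, and only the edge leaving the sink is missing.\<close>
  define X1 where "X1 b a k = {(0, i) | i. i < n - b \<or> (n - a \<le> i \<and> i < n)}
      \<union> {(j, t) | j t. 1 \<le> j \<and> j < m \<and> 1 \<le> t \<and> t \<le> k j}" for a b :: nat and k :: "nat \<Rightarrow> nat"
  have X1_iff: "(x, i) \<in> X1 b a k \<longleftrightarrow> (x = 0 \<and> (i < n - b \<or> (n - a \<le> i \<and> i < n)))
      \<or> (1 \<le> x \<and> x < m \<and> 1 \<le> i \<and> i \<le> k x)" for x i b a k
    unfolding X1_def by auto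
  define X2 where "X2 b a = {(0 :: nat, i) | i. a < i \<and> i \<le> b + 1}" for a b :: nat
  define X3 where "X3 j b a = {(j, t) | t. a < t \<and> t \<le> b + 1}" for j a b :: nat
  define f1 where "f1 = (\<lambda>((b, a), k). ((0 :: nat, n - 1 - b), X1 b a k))"
  define f2 where "f2 = (\<lambda>(b, a). ((0 :: nat, b + 1), X2 b a))"
  \<comment> \<open>On a pendent path the arrows decrease the second coordinate, so the sink is the
    lower end \<open>a + 1\<close>, unlike in \<open>f2\<close>.\<close>
  define f3 where "f3 = (\<lambda>(j, b, a). ((j, a + 1), X3 j b a))"
  have R1: "rooted (0, n - 1 - b) (X1 b a k)"
    if h: "b < n" "a \<le> b" "k \<in> (\<Pi>\<^sub>E j\<in>{1..<m}. {..L ! j})" for a b k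
    unfolding rooted_def
  proof (intro conjI ballI impI)
    have "t \<le> L ! j" if "1 \<le> j" "j < m" "t \<le> k j" for j t
    proof -
      have "k j \<in> {..L ! j}" using PiE_mem[OF h(3), of j] that by simp
      then show ?thesis using that by simp
    qed
    then show "X1 b a k \<subseteq> U1_V L"
      using h n3 by (auto simp: X1_def U1_V_cases n_def m_def)
    show "(0, n - 1 - b) \<in> X1 b a k" using h by (auto simp: X1_def)
    fix v assume v: "v \<in> X1 b a k"
    show "lollipop_next (hd L) v \<in> X1 b a k" if "v \<noteq> (0, n - 1 - b)"
    proof -
      obtain x i where vx: "v = (x, i)" by (cases v)
      show ?thesis
      proof (cases "x = 0")
        case True
        then have i: "i < n - b \<or> (n - a \<le> i \<and> i < n)" "i \<noteq> n - 1 - b"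
          using v that vx X1_iff by auto
        have "lollipop_next (hd L) v = (0, if i + 1 = n then 0 else i + 1)"
          using True vx i(1) n3 by (auto simp: lollipop_next_def n_def)
        moreover have "(0, if i + 1 = n then 0 else i + 1) \<in> X1 b a k"
          unfolding X1_iff using i h(1) by auto
        ultimately show ?thesis by simp
      next
        case False
        then have i: "1 \<le> x" "x < m" "1 \<le> i" "i \<le> k x" using v vx X1_iff by auto
        have "lollipop_next (hd L) v = (if i = 1 then (0, 0) else (x, i - 1))"
          using False vx i(3) by (auto simp: lollipop_next_def)
        moreover have "(if i = 1 then (0, 0) else (x, i - 1)) \<in> X1 b a k"
          using i h(1) X1_iff by auto
        ultimately show ?thesis by simp
      qed
    qed
    show "\<exists>i. (lollipop_next (hd L) ^^ i) v = (0, n - 1 - b)"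
    proof (cases "fst v = 0")
      case True
      then show ?thesis using v h n3 lollipop_reach_cycle[of "snd v" n "n - 1 - b"]
        by (cases v) (auto simp: X1_def n_def)
    next
      case False
      then show ?thesis using v h n3 lollipop_reach_path[of "fst v" "snd v" "n - 1 - b" n]
        by (cases v) (auto simp: X1_def n_def)
    qed
  qed
  have R2: "rooted (0, b + 1) (X2 b a)" if h: "b < n - 1" "a \<le> b" for a b
    unfolding rooted_def
  proof (intro conjI ballI impI)
    show "X2 b a \<subseteq> U1_V L" using h by (auto simp: X2_def U1_V_cases n_def)
    show "(0, b + 1) \<in> X2 b a" using h by (auto simp: X2_def)
    fix v assume v: "v \<in> X2 b a"
    show "lollipop_next (hd L) v \<in> X2 b a" if "v \<noteq> (0, b + 1)"
      using v that h unfolding n_def[symmetric] by (auto simp: X2_def lollipop_next_def)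
    show "\<exists>i. (lollipop_next (hd L) ^^ i) v = (0, b + 1)"
      using v h lollipop_reach_cycle[of "snd v" n "b + 1"] by (auto simp: X2_def n_def)
  qed
  have R3: "rooted (j, a + 1) (X3 j b a)" if h: "1 \<le> j" "j < m" "b < L ! j" "a \<le> b" for j a b
    unfolding rooted_def
  proof (intro conjI ballI impI)
    show "X3 j b a \<subseteq> U1_V L" using h by (auto simp: X3_def U1_V_cases m_def)
    show "(j, a + 1) \<in> X3 j b a" using h by (auto simp: X3_def)
    fix v assume v: "v \<in> X3 j b a"
    show "lollipop_next (hd L) v \<in> X3 j b a" if "v \<noteq> (j, a + 1)"
      using v that h by (auto simp: X3_def lollipop_next_def)
    show "\<exists>i. (lollipop_next (hd L) ^^ i) v = (j, a + 1)"
      using v h lollipop_next_path[of j "snd v - (a + 1)" "snd v" "hd L"]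
      by (intro exI[of _ "snd v - (a + 1)"]) (auto simp: X3_def)
  qed
  have sub: "f1 ` I1 \<union> f2 ` I2 \<union> f3 ` I3 \<subseteq> {(t, X). rooted t X}"
    using R1 R2 R3 by (auto simp: f1_def f2_def f3_def I1_def I2_def I3_def)
  have inj1: "inj_on f1 I1"
  proof (rule inj_onI)
    fix u u' assume u: "u \<in> I1" "u' \<in> I1" "f1 u = f1 u'"
    obtain b a k b' a' k' where uu: "u = ((b, a), k)" "u' = ((b', a'), k')" by (metis surj_pair)
    have h: "b < n" "a \<le> b" "k \<in> (\<Pi>\<^sub>E j\<in>{1..<m}. {..L ! j})"
        "b' < n" "a' \<le> b'" "k' \<in> (\<Pi>\<^sub>E j\<in>{1..<m}. {..L ! j})"
      using u unfolding uu I1_def by auto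
    have bb: "b = b'" and XX: "X1 b a k = X1 b' a' k'" using u h unfolding uu f1_def by auto
    have "(0, i) \<in> X1 b a k \<longleftrightarrow> (0, i) \<in> X1 b' a' k'" for i using XX by simp
    then have i: "i < n - b \<or> (n - a \<le> i \<and> i < n) \<longleftrightarrow> i < n - b \<or> (n - a' \<le> i \<and> i < n)" for i
      unfolding X1_def bb by auto
    \<comment> \<open>The cycle vertices with index \<open>n - a'\<close> and \<open>n - a\<close>
      tell different values of \<open>a\<close> apart.\<close>
    have "\<not> a < a'" using i[of "n - a'"] h bb by linarith
    moreover have "\<not> a' < a" using i[of "n - a"] h bb by linarith
    ultimately have "a = a'" by simp
    moreover have "k = k'"
    proof (rule PiE_ext[OF h(3,6)])
      fix j assume j: "j \<in> {1..<m}"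
      have "(j, t) \<in> X1 b a k \<longleftrightarrow> (j, t) \<in> X1 b' a' k'" for t using XX by simp
      then have "1 \<le> t \<and> t \<le> k j \<longleftrightarrow> 1 \<le> t \<and> t \<le> k' j" for t
        using j unfolding X1_def by auto
      from this[of "k j"] this[of "k' j"] show "k j = k' j" by linarith
    qed
    ultimately show "u = u'" using uu bb by simp
  qed
  have inj2: "inj_on f2 I2"
  proof (rule inj_onI)
    fix u u' assume u: "u \<in> I2" "u' \<in> I2" "f2 u = f2 u'"
    obtain b a b' a' where uu: "u = (b, a)" "u' = (b', a')" by (metis surj_pair)
    have h: "a \<le> b" "a' \<le> b'" using u unfolding uu I2_def by auto
    have bb: "b = b'" and XX: "X2 b a = X2 b' a'" using u unfolding uu f2_def by auto
    have "(0, i) \<in> X2 b a \<longleftrightarrow> (0, i) \<in> X2 b' a'" for i using XX by simp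
    then have "a < i \<and> i \<le> b + 1 \<longleftrightarrow> a' < i \<and> i \<le> b + 1" for i unfolding X2_def bb by auto
    from this[of "a + 1"] this[of "a' + 1"] show "u = u'" using uu bb h by auto
  qed
  have inj3: "inj_on f3 I3"
  proof (rule inj_onI)
    fix u u' assume u: "u \<in> I3" "u' \<in> I3" "f3 u = f3 u'"
    obtain j b a j' b' a' where uu: "u = (j, b, a)" "u' = (j', b', a')" by (metis surj_pair)
    have h: "a \<le> b" "a' \<le> b'" using u unfolding uu I3_def by auto
    have aa: "j = j'" "a = a'" and XX: "X3 j b a = X3 j' b' a'" using u unfolding uu f3_def by auto
    have "(j, i) \<in> X3 j b a \<longleftrightarrow> (j, i) \<in> X3 j' b' a'" for i using XX by simp
    then have "a < i \<and> i \<le> b + 1 \<longleftrightarrow> a < i \<and> i \<le> b' + 1" for i unfolding X3_def aa by auto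
    from this[of "b + 1"] this[of "b' + 1"] show "u = u'" using uu aa h by auto
  qed
  \<comment> \<open>The three families are separated by whether the sink has first coordinate 0 and
    whether the subtree contains \<open>(0, 0)\<close>.\<close>
  have z1: "(0, 0) \<in> snd w \<and> fst (fst w) = 0" if "w \<in> f1 ` I1" for w
    using that by (auto simp: f1_def I1_def X1_def)
  have z2: "(0, 0) \<notin> snd w \<and> fst (fst w) = 0" if "w \<in> f2 ` I2" for w
    using that by (auto simp: f2_def I2_def X2_def)
  have z3: "fst (fst w) \<noteq> 0" if "w \<in> f3 ` I3" for w
    using that by (auto simp: f3_def I3_def)
  have fin: "finite I1" "finite I2" "finite I3"
    by (auto simp: I1_def I2_def I3_def intro!: finite_PiE)
  have "card (f1 ` I1 \<union> f2 ` I2 \<union> f3 ` I3) = card (f1 ` I1) + card (f2 ` I2) + card (f3 ` I3)"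
  proof -
    have "f1 ` I1 \<inter> f2 ` I2 = {}" using z1 z2 by blast
    moreover have "(f1 ` I1 \<union> f2 ` I2) \<inter> f3 ` I3 = {}" using z1 z2 z3 by blast
    ultimately show ?thesis using fin by (simp add: card_Un_disjoint)
  qed
  also have "\<dots> = card I1 + card I2 + card I3"
    using inj1 inj2 inj3 by (simp add: card_image)
  also have "card I1 = triangle n * (\<Prod>j\<in>{1..<m}. L ! j + 1)"
    unfolding I1_def by (simp add: card_cartesian_product card_ordered_pairs card_PiE)
  also have "card I2 = triangle (n - 1)" by (simp add: I2_def card_ordered_pairs)
  also have "card I3 = (\<Sum>j\<in>{1..<m}. triangle (L ! j))"
    unfolding I3_def by (subst card_SigmaI) (auto simp: card_ordered_pairs)
  finally have "card (f1 ` I1 \<union> f2 ` I2 \<union> f3 ` I3)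
      = triangle n * (\<Prod>j\<in>{1..<m}. L ! j + 1) + triangle (n - 1) + (\<Sum>j\<in>{1..<m}. triangle (L ! j))" .
  moreover have "finite {(t, X). rooted t X}"
    by (rule finite_subset[of _ "U1_V L \<times> Pow (U1_V L)"]) (auto simp: rooted_def finV)
  then have "card (f1 ` I1 \<union> f2 ` I2 \<union> f3 ` I3) \<le> card {(t, X). rooted t X}"
    using sub by (rule card_mono)
  ultimately show ?thesis
    using num_subtrees_eq U1_edges[OF l] by (simp add: n_def m_def)
qed

subsection \<open>Unicyclic graphs as functional graphs\<close>

text \<open>The path is built from its front; if the new vertex already occurs, everything before
  that occurrence is dropped.\<close>

lemma adj_path_distinct:
  assumes "(adj F)\<^sup>*\<^sup>* x y"
  shows "\<exists>vs. vs \<noteq> [] \<and> hd vs = x \<and> last vs = y \<and> distinct vs \<and> successively (adj F) vs"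
  using assms
proof (induction rule: converse_rtranclp_induct)
  case base
  show ?case by (rule exI[of _ "[y]"]) simp
next
  case (step x z)
  then obtain vs where vs: "vs \<noteq> []" "hd vs = z" "last vs = y" "distinct vs" "successively (adj F) vs"
    by blast
  show ?case
  proof (cases "x \<in> set vs")
    case True
    then obtain as bs where ab: "vs = as @ x # bs" by (meson split_list)
    then have "last (x # bs) = y" "distinct (x # bs)" "successively (adj F) (x # bs)"
      using vs by (auto simp: successively_append_iff)
    then show ?thesis by (intro exI[of _ "x # bs"]) simp
  next
    case False
    then show ?thesis using vs step.hyps
      by (intro exI[of _ "x # vs"]) (auto simp: successively_Cons)
  qed
qed

text \<open>A simple path from \<open>x\<close> to \<open>y\<close> in \<open>F\<close> is closed up
  by the new edge. It has at least three vertices, because \<open>x\<close> and \<open>y\<close> are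
  distinct and not adjacent in \<open>F\<close>.\<close>

lemma cycle_through_new_edge:
  assumes "(adj F)\<^sup>*\<^sup>* x y" "x \<noteq> y" "{x, y} \<notin> F" "insert {x, y} F \<subseteq> E"
  shows "\<exists>Y. is_cycle E Y \<and> {x, y} \<in> Y"
proof -
  obtain vs where vs: "vs \<noteq> []" "hd vs = x" "last vs = y" "distinct vs" "successively (adj F) vs"
    using adj_path_distinct[OF assms(1)] by blast
  define n where "n = length vs"
  have n0: "0 < n" using vs by (simp add: n_def)
  have ends: "vs ! 0 = x" "vs ! (n - 1) = y"
    using vs by (simp_all add: hd_conv_nth last_conv_nth n_def)
  have st: "{vs ! i, vs ! Suc i} \<in> F" if "Suc i < n" for i
    using successively_nth[OF vs(5), of i] that by (simp add: n_def adj_def)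
  have "n \<noteq> 1" using ends assms(2) by auto
  moreover have "n \<noteq> 2"
  proof
    assume "n = 2"
    then show False using ends st[of 0] assms(3) by simp
  qed
  ultimately have n3: "3 \<le> n" using n0 by linarith
  define Y where "Y = {{vs ! i, vs ! ((i + 1) mod n)} | i. i < n}"
  have "{vs ! (n - 1), vs ! ((n - 1 + 1) mod n)} \<in> Y" unfolding Y_def using n0 by force
  then have xy: "{x, y} \<in> Y" using ends n0 by (simp add: insert_commute)
  have "Y \<subseteq> E"
  proof
    fix e assume "e \<in> Y"
    then obtain i where i: "i < n" "e = {vs ! i, vs ! ((i + 1) mod n)}" unfolding Y_def by blast
    show "e \<in> E"
    proof (cases "Suc i < n")
      case True
      then show ?thesis using i st[of i] assms(4) by auto
    next
      case False
      then have "i = n - 1" "Suc i = n" using i by auto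
      then have "e = {x, y}" using i ends by (simp add: insert_commute)
      then show ?thesis using assms(4) by blast
    qed
  qed
  then have "is_cycle E Y" unfolding is_cycle_def Y_def using n3 vs(4) n_def by blast
  then show ?thesis using xy by blast
qed

text \<open>Let \<open>g\<close> rotate the cycle and move every other vertex to a neighbour nearer
  to it. The resulting edges connect \<open>V\<close> and contain the cycle; any further edge of
  \<open>E\<close> would lie on a cycle, which by uniqueness is the given one, whose edges are
  already present.\<close>

lemma unicyclic_functional_graph:
  assumes "unicyclic V E"
  shows "\<exists>g r. functional_graph V g r \<and> functional_graph.edges V g = E"
proof -
  have finV: "finite V" and EV: "E \<subseteq> {{u, v} | u v. u \<in> V \<and> v \<in> V \<and> u \<noteq> v}"
    and conn: "\<And>u v. u \<in> V \<Longrightarrow> v \<in> V \<Longrightarrow> (adj E)\<^sup>*\<^sup>* u v"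
    using assms unfolding unicyclic_def simple_graph_def connected_graph_def by auto
  obtain Y where Y: "is_cycle E Y" "\<And>Y'. is_cycle E Y' \<Longrightarrow> Y' = Y"
    using assms unfolding unicyclic_def by blast
  obtain cs where cs: "3 \<le> length cs" "distinct cs"
    "Y = {{cs ! i, cs ! ((i + 1) mod length cs)} | i. i < length cs}" "Y \<subseteq> E"
    using Y(1) unfolding is_cycle_def by blast
  define n where "n = length cs"
  have n3: "3 \<le> n" using cs n_def by simp
  have ein: "u \<in> V \<and> v \<in> V" if "{u, v} \<in> E" for u v
    using EV that by (fastforce simp: doubleton_eq_iff)
  have ce: "{cs ! i, cs ! ((i + 1) mod n)} \<in> Y" if "i < n" for i
    using that unfolding cs(3) n_def by blast
  have cV: "cs ! i \<in> V" if "i < n" for i using ce[OF that] cs(4) ein by blast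
  have cinj: "i = j" if "cs ! i = cs ! j" "i < n" "j < n" for i j
    using nth_eq_iff_index_eq[OF cs(2)] that n_def by blast
  define K where "K = (\<lambda>i. cs ! i) ` {..<n}"
  \<comment> \<open>The distance to the cycle, whose vertex set is \<open>K\<close>. Its strict
    decrease along \<open>g\<close> off \<open>K\<close> gives both
    \<open>g (g v) \<noteq> v\<close> there and the termination of the walk.\<close>
  define d where "d v = (LEAST k. \<exists>w\<in>K. (adj E ^^ k) v w)" for v
  have dex: "\<exists>w\<in>K. (adj E ^^ d v) v w" if vV: "v \<in> V" for v
  proof -
    have "cs ! 0 \<in> K" using n3 by (auto simp: K_def)
    moreover obtain k where "(adj E ^^ k) v (cs ! 0)"
      using conn[OF vV cV[of 0]] n3 rtranclp_imp_relpowp by fastforce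
    ultimately have "\<exists>w\<in>K. (adj E ^^ k) v w" by blast
    then show ?thesis unfolding d_def by (rule LeastI)
  qed
  have down: "\<exists>u. {v, u} \<in> E \<and> d u < d v" if v: "v \<in> V" "v \<notin> K" for v
  proof -
    obtain w where w: "w \<in> K" "(adj E ^^ d v) v w" using dex v by blast
    have "d v \<noteq> 0"
    proof
      assume "d v = 0"
      then show False using w v by simp
    qed
    then obtain k where k: "d v = Suc k" using not0_implies_Suc by blast
    then obtain u where u: "adj E v u" "(adj E ^^ k) u w" using w(2) relpowp_Suc_D2 by metis
    have "d u \<le> k" unfolding d_def using u w by (intro Least_le) blast
    then show ?thesis using u k by (auto simp: adj_def)
  qed
  have "\<exists>u. (v \<in> K \<longrightarrow> (\<exists>i<n. v = cs ! i \<and> u = cs ! ((i + 1) mod n)))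
      \<and> (v \<in> V - K \<longrightarrow> {v, u} \<in> E \<and> d u < d v)" for v
    using down[of v] unfolding K_def by auto
  then obtain g where g: "\<And>v. v \<in> K \<Longrightarrow> \<exists>i<n. v = cs ! i \<and> g v = cs ! ((i + 1) mod n)"
    "\<And>v. v \<in> V - K \<Longrightarrow> {v, g v} \<in> E \<and> d (g v) < d v"
    by metis
  have gK: "g (cs ! i) = cs ! ((i + 1) mod n)" if "i < n" for i
  proof -
    have "cs ! i \<in> K" using that by (simp add: K_def)
    then obtain j where "j < n" "cs ! i = cs ! j" "g (cs ! i) = cs ! ((j + 1) mod n)" using g(1) by blast
    then show ?thesis using cinj that by blast
  qed
  have gK_in: "g v \<in> K" if "v \<in> K" for v
    using that gK n3 by (auto simp: K_def)
  have gE: "{v, g v} \<in> E" if "v \<in> V" for v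
  proof (cases "v \<in> K")
    case True
    then obtain i where "i < n" "v = cs ! i" by (auto simp: K_def)
    then show ?thesis using gK ce cs(4) by auto
  qed (use g(2) that in blast)
  have itK: "(g ^^ k) (cs ! i) = cs ! ((i + k) mod n)" if "i < n" for i k
    using that n3 by (induction k) (simp_all add: gK mod_Suc_eq)
  have fg: "functional_graph V g (cs ! 0)"
  proof
    show "finite V" by fact
    show "cs ! 0 \<in> V" using cV n3 by simp
    fix v assume v: "v \<in> V"
    show "g v \<in> V" using gE ein v by blast
    show "g v \<noteq> v"
    proof (cases "v \<in> K")
      case True
      then obtain i where i: "i < n" "v = cs ! i" by (auto simp: K_def)
      have "(i + 1) mod n \<noteq> i" "(i + 1) mod n < n" using i n3 by (simp_all add: mod_if)
      then show ?thesis using gK i cinj by metis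
    qed (use g(2) v in force)
    show "g (g v) \<noteq> v"
    proof (cases "v \<in> K")
      case True
      then obtain i where i: "i < n" "v = cs ! i" by (auto simp: K_def)
      have "((i + 1) mod n + 1) mod n \<noteq> i" "((i + 1) mod n + 1) mod n < n" "(i + 1) mod n < n"
        using i n3 by (simp_all add: mod_if)
      then show ?thesis using gK i cinj by metis
    next
      case False
      then have "d (g v) < d v" using g(2) v by blast
      then show ?thesis
        using gK_in False g(2)[of "g v"] \<open>g v \<in> V\<close> by (cases "g v \<in> K") force+
    qed
    show "\<exists>i. (g ^^ i) v = cs ! 0"
      using v
    proof (induction "d v" arbitrary: v rule: less_induct)
      case less
      show ?case
      proof (cases "v \<in> K")
        case True
        then obtain i where i: "i < n" "v = cs ! i" by (auto simp: K_def)
        then have "(g ^^ (n - i)) v = cs ! 0" using itK by simp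
        then show ?thesis by blast
      next
        case False
        then have "d (g v) < d v" "g v \<in> V" using g(2) gE ein less.prems by blast+
        then obtain i where "(g ^^ i) (g v) = cs ! 0" using less.hyps by blast
        then have "(g ^^ Suc i) v = cs ! 0" by (simp add: funpow_swap1)
        then show ?thesis by blast
      qed
    qed
  qed
  then interpret functional_graph V g "cs ! 0" .
  have edE: "edges \<subseteq> E" using gE by (auto simp: edges_def edge_def)
  have path: "(adj edges)\<^sup>*\<^sup>* v (cs ! 0)" if v: "v \<in> V" for v
  proof -
    obtain i where "(g ^^ i) v = cs ! 0" using reach v by blast
    then show ?thesis using v
    proof (induction i arbitrary: v)
      case (Suc i)
      have "adj edges v (g v)" using Suc.prems by (auto simp: adj_def edges_def edge_def)
      moreover have "(adj edges)\<^sup>*\<^sup>* (g v) (cs ! 0)"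
        using Suc g_in by (simp add: funpow_swap1)
      ultimately show ?case by (rule converse_rtranclp_into_rtranclp)
    qed simp
  qed
  have Yed: "Y \<subseteq> edges"
  proof
    fix e assume "e \<in> Y"
    then obtain i where "i < n" "e = {cs ! i, cs ! ((i + 1) mod n)}" unfolding cs(3) n_def by blast
    then show "e \<in> edges" using gK cV by (auto simp: edges_def edge_def)
  qed
  have "E \<subseteq> edges"
  proof
    fix e assume e: "e \<in> E"
    then obtain x y where xy: "e = {x, y}" "x \<in> V" "y \<in> V" "x \<noteq> y" using EV by blast
    show "e \<in> edges"
    proof (rule ccontr)
      assume ne: "e \<notin> edges"
      have "(adj edges)\<^sup>*\<^sup>* x y"
        using path adj_rtranclp_sym xy by (meson rtranclp_trans)
      then obtain Y' where "is_cycle E Y'" "e \<in> Y'"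
        using cycle_through_new_edge[of edges x y E] xy ne e edE by blast
      then show False using Y(2) Yed ne by blast
    qed
  qed
  then show ?thesis using fg edE by blast
qed

subsection \<open>Comparison\<close>

text \<open>Passes from the list of lengths to the index set of segments. The head is split off
  because it becomes the cycle of the extremal graph, the other entries its pendent paths.\<close>

lemma sum_nth_eq_sum_mset:
  fixes f :: "nat \<Rightarrow> nat"
  assumes "mset xs = image_mset h (mset_set A)" "xs \<noteq> []"
  shows "f (hd xs) + (\<Sum>j\<in>{1..<length xs}. f (xs ! j)) = (\<Sum>v\<in>A. f (h v))"
proof -
  have "{..<length xs} = insert 0 {1..<length xs}" using assms(2) by auto
  then have "(\<Sum>j<length xs. f (xs ! j)) = f (hd xs) + (\<Sum>j\<in>{1..<length xs}. f (xs ! j))"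
    using assms(2) by (simp add: hd_conv_nth)
  moreover have "(\<Sum>j<length xs. f (xs ! j)) = sum_mset (image_mset f (mset xs))"
    using sum.list_conv_set_nth[of "map f xs"] sum_mset_sum_list[of "map f xs"]
    by (simp add: lessThan_atLeast0)
  ultimately show ?thesis
    by (simp add: assms(1) image_mset.compositionality o_def flip: sum_unfold_sum_mset)
qed

lemma prod_nth_eq_prod_mset:
  fixes f :: "nat \<Rightarrow> nat"
  assumes "mset xs = image_mset h (mset_set A)" "xs \<noteq> []"
  shows "f (hd xs) * (\<Prod>j\<in>{1..<length xs}. f (xs ! j)) = (\<Prod>v\<in>A. f (h v))"
proof -
  have "{..<length xs} = insert 0 {1..<length xs}" using assms(2) by auto
  then have "(\<Prod>j<length xs. f (xs ! j)) = f (hd xs) * (\<Prod>j\<in>{1..<length xs}. f (xs ! j))"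
    using assms(2) by (simp add: hd_conv_nth)
  moreover have "(\<Prod>j<length xs. f (xs ! j)) = prod_mset (image_mset f (mset xs))"
    using prod.list_conv_set_nth[of "map f xs"] prod_mset_prod_list[of "map f xs"]
    by (simp add: lessThan_atLeast0)
  ultimately show ?thesis
    by (simp add: assms(1) image_mset.compositionality o_def flip: prod_unfold_prod_mset)
qed

theorem theorem3:
  fixes V :: "'a set" and E :: "'a set set" and L :: "nat list"
  assumes "L \<noteq> []"
    and "sorted_wrt (\<ge>) L"
    and "hd L \<ge> 3"
    and "unicyclic V E"
    and "segment_seq E = mset L"
  shows "num_subtrees V E \<le> num_subtrees (U1_V L) (U1_E L)"
proof -
  obtain g r where fg: "functional_graph V g r" and E: "functional_graph.edges V g = E"
    using unicyclic_functional_graph[OF assms(4)] by blast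
  interpret functional_graph V g r by (rule fg)
  \<comment> \<open>A graph that is just a cycle has no segments, which contradicts that
    \<open>L\<close> is nonempty.\<close>
  have N_ne: "N \<noteq> {}"
  proof
    assume "N = {}"
    then have "{S. is_segment E S} = {}" using segment_chain E by blast
    then have "segment_seq E = {#}" by (simp add: segment_seq_def)
    then show False using assms by simp
  qed
  define m where "m = hd L"
  define c where "c = period"
  define D where "D = (\<Prod>v\<in>N \<inter> C. len v + 1)"
  define P where "P = (\<Prod>v\<in>N - C. len v + 1)"
  define T where "T = (\<Sum>v\<in>N. triangle (len v))"
  define Q where "Q = (\<Prod>j\<in>{1..<length L}. L ! j + 1)"
  define S where "S = (\<Sum>j\<in>{1..<length L}. triangle (L ! j))"
  have L: "mset L = image_mset len (mset_set N)" using segment_seq_eq assms(5) E by simp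
  have le: "len v \<le> m" if "v \<in> N" for v
  proof -
    have "len v \<in># mset L" using that finN by (simp add: L)
    then have "len v \<in> set L" by simp
    then show ?thesis using assms(1,2) unfolding m_def by (cases L) auto
  qed
  \<comment> \<open>Both sides are the product of \<open>l + 1\<close> over the common segment
    sequence, split by position relative to the cycle in the given graph and in the extremal
    graph.\<close>
  have DP: "D * P = (m + 1) * Q"
    using prod_nth_eq_prod_mset[OF L assms(1), of "\<lambda>x. x + 1"] prod.Int_Diff[OF finN, of "\<lambda>v. len v + 1" C]
    unfolding D_def P_def Q_def m_def by simp
  have TS: "T = triangle m + S"
    using sum_nth_eq_sum_mset[OF L assms(1), of triangle] unfolding T_def S_def m_def by simp
  have cs: "c = (\<Sum>v\<in>N \<inter> C. len v)" using period_sum[OF N_ne] by (simp add: c_def)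
  have "c * (c + 1) * P + 2 * m \<le> m * (D * P) + 2 * c"
  proof (rule weighted_prod_bound)
    show "c * (c + 1) \<le> m * D"
      unfolding cs D_def using finN le assms(3) by (intro sum_mult_le_prod) (auto simp: m_def)
    show "c + 1 \<le> D" unfolding cs D_def using finN by (intro sum_le_prod_Suc) simp
    show "1 \<le> c" using period_ge3 by (simp add: c_def)
    have "0 < P" unfolding P_def by (intro prod_pos) simp
    then show "1 \<le> P" by simp
  qed
  moreover have "2 * card {(t, X). rooted t X} + 2 * c \<le> 2 * T + c * (c + 1) * P"
    using card_rooted_le[OF N_ne] unfolding c_def T_def P_def .
  moreover have "m * (D * P) = 2 * (triangle m * Q)"
    unfolding DP using two_triangle[of m] by (metis mult.assoc)
  \<comment> \<open>The summand \<open>2 * m\<close> of the comparison turns \<open>2 * T\<close>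
    into \<open>2 * (triangle (m - 1) + S)\<close>, and the two terms \<open>2 * c\<close>
    cancel.\<close>
  moreover have "triangle m = triangle (m - 1) + m"
    using triangle_Suc[of "m - 1"] assms(3) by (simp add: m_def)
  ultimately have "card {(t, X). rooted t X} \<le> triangle m * Q + triangle (m - 1) + S"
    using TS by linarith
  then show ?thesis
    using num_subtrees_eq U1_num_subtrees_ge[OF assms(3)] unfolding E m_def Q_def S_def by linarith
qed

end
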